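(* Let $Q:\mathbf{T}\to\mathbb{R}$ be a $C^{1}$ potential. (1) For $\rho>0$, if $Q$ satisfies $HWI(\rho)$, then $Q$ satisfies $LSI(\rho)$. (2) If $Q$ satisfies $HWI(\rho)$ for some $\rho\in\mathbb{R}$ and $Q$ satisfies $T(C)$ with $C>\max\{0,-\rho\}$, then $Q$ satisfies $LSI(K)$ with constant $$K=\begin{cases}\frac{(C+\rho)^{2}}{4C} & \rho\le0,\\ \rho & \rho>C>0,\\ \frac{(C+\rho)^{2}}{4C} & 0<\rho\le C.\end{cases}$$ In particular, if $\rho>0$ and $C>\rho$, then $K>\rho$.
   Context: $\mathbf{T}$ is the unit circle in $\mathbb{C}$ and $\alpha$ is the normalized (probability) Haar measure on $\mathbf{T}$. A measure on $\mathbf{T}$ is called smooth if it has a smooth density with respect to $\alpha$. For a differentiable function $\phi$ on $\mathbf{T}$, $\phi'(z)=\frac{d}{dt}\big|_{t=0}\phi(ze^{it})$. For a continuous $Q:\mathbf{T}\to\mathbb{R}$ (a potential) and a probability measure $\mu$ on $\mathbf{T}$, $E_Q(\mu)=\int Q\,d\mu-\iint\log|x-y|\,\mu(dx)\mu(dy)$; $\mu_Q$ denotes the (unique) minimizer of $E_Q$ over probability measures on $\mathbf{T}$. For a smooth probability measure $\mu$ on $\mathbf{T}$, with density $m$ with respect to $\alpha$, define $H\mu:\mathbf{T}\to\mathbb{R}$ by the principal value integral $H\mu(e^{ix})=\mathrm{p.v.}\int\cot\big(\frac{x-y}{2}\big)\,m(e^{iy})\,\frac{dy}{2\pi}$ over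 an interval of length $2\pi$, and $I_Q(\mu)=\int(H\mu-Q')^{2}\,d\mu-\big(\int Q'\,d\mu\big)^{2}$ (this is non-negative). Modified Wasserstein distance: let $\exp(x)=e^{ix}$ for $x\in\mathbb{R}$. For a measure $\mu$ on $\mathbf{T}$ let $\bar\mu$ be the measure on $\mathbb{R}$ given by $\bar\mu(A)=\sum_{n\in\mathbb{Z}}\mu(\exp(A\cap[2n\pi,2(n+1)\pi)))$, and let $\bar\mu_u$ be the restriction of $\bar\mu$ to $[u,u+2\pi)$. For probability measures $\mu,\nu$ on $\mathbf{T}$ and $p\ge1$, $$\mathcal{W}_p(\mu,\nu)=\sup\Big\{W_p(\bar\mu_u,\bar\nu_v): u,v\in[0,2\pi],\ \int x\,\bar\mu_u(dx)=\int x\,\bar\nu_v(dx)\Big\},$$ where $W_p$ is the standard $p$-Wasserstein distance on $\mathbb{R}$ (cost $|x-y|^p$, with the power $1/p$), and the supremum over the empty set is $+\infty$. Inequalities: - $Q$ satisfies $T(\rho)$ ($\rho>0$) if $\rho\,\mathcal{W}_2^{2}(\mu,\mu_Q)\le E_Q(\mu)-E_Q(\mu_Q)$ for every smooth probability measure $\mu$ on $\mathbf{T}$. - $Q$ satisfies $LSI(\rho)$ ($\rho>0$) if $E_Q(\mu)-E_Q(\mu_Q)\le\frac{1}{4\rho}I_Q(\mu)$ for every smooth probability measure $\mu$ on $\mathbf{T}$. - $Q$ satisfies $HWI(\rho)$ ($\rho\in\mathbb{R}$) if $E_Q(\mu)-E_Q(\mu_Q)\le\sqrt{I_Q(\mu)}\,\mathcal{W}_2(\mu,\mu_Q)-\rho\,\mathcal{W}_2^{2}(\mu,\mu_Q)$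 for every smooth probability measure $\mu$ on $\mathbf{T}$. *)

theory Defs
  imports "HOL-Probability.Probability"
begin

section \<open>The unit circle\<close>

abbreviation circle :: "complex set" where
  "circle \<equiv> sphere 0 1"

abbreviation circle_borel :: "complex measure" where
  "circle_borel \<equiv> restrict_space borel circle"

definition circle_haar :: "complex measure" where
  "circle_haar = distr (uniform_measure lborel {0..<2 * pi}) circle_borel cis"

definition circle_prob :: "complex measure \<Rightarrow> bool" where
  "circle_prob \<mu> \<longleftrightarrow> prob_space \<mu> \<and> sets \<mu> = sets circle_borel"

text \<open>
  Functions on the circle are functions on \<^typ>\<open>complex\<close> of which only the values on
  \<^const>\<open>circle\<close> matter; differentiation is along \<open>t \<mapsto> z * exp (i t)\<close>, so it never
  leaves the circle.
\<close>

definition circle_deriv :: "(complex \<Rightarrow> real) \<Rightarrow> complex \<Rightarrow> real" where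
  "circle_deriv f z = deriv (\<lambda>t::real. f (z * cis t)) 0"

definition circle_differentiable :: "(complex \<Rightarrow> real) \<Rightarrow> bool" where
  "circle_differentiable f \<longleftrightarrow> (\<forall>z\<in>circle. (\<lambda>t::real. f (z * cis t)) differentiable (at 0))"

definition circle_C1 :: "(complex \<Rightarrow> real) \<Rightarrow> bool" where
  "circle_C1 f \<longleftrightarrow> circle_differentiable f \<and> continuous_on circle (circle_deriv f)"

definition circle_smooth :: "(complex \<Rightarrow> real) \<Rightarrow> bool" where
  "circle_smooth f \<longleftrightarrow> (\<forall>k. circle_differentiable ((circle_deriv ^^ k) f))"

definition smooth_density_of :: "complex measure \<Rightarrow> (complex \<Rightarrow> real) \<Rightarrow> bool" where
  "smooth_density_of \<mu> m \<longleftrightarrow>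
     circle_smooth m \<and> (\<forall>z\<in>circle. m z \<ge> 0) \<and> \<mu> = density circle_haar (\<lambda>z. ennreal (m z))"

definition smooth_circle_prob :: "complex measure \<Rightarrow> bool" where
  "smooth_circle_prob \<mu> \<longleftrightarrow> circle_prob \<mu> \<and> (\<exists>m. smooth_density_of \<mu> m)"

text \<open>Two smooth densities of the same measure agree on the circle, so the choice is immaterial.\<close>

definition smooth_density :: "complex measure \<Rightarrow> complex \<Rightarrow> real" where
  "smooth_density \<mu> = (SOME m. smooth_density_of \<mu> m)"


section \<open>Logarithmic energy and equilibrium measure\<close>

text \<open>
  The integral of \<open>- log \<bar>x - y\<bar>\<close> is taken in the extended reals, as the integral of the positive
  part minus the integral of the negative part; the latter is at most \<open>ln 2\<close>. On the diagonal the
  integrand is \<open>\<infinity>\<close>, which must be said explicitly because \<open>ln 0 = 0\<close> here.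
\<close>

definition log_energy :: "complex measure \<Rightarrow> ereal" where
  "log_energy \<mu> =
     enn2ereal (\<integral>\<^sup>+ (x, y). (if x = y then \<infinity> else ennreal (- ln (dist x y))) \<partial>(\<mu> \<Otimes>\<^sub>M \<mu>))
   - enn2ereal (\<integral>\<^sup>+ (x, y). ennreal (ln (dist x y)) \<partial>(\<mu> \<Otimes>\<^sub>M \<mu>))"

definition energy :: "(complex \<Rightarrow> real) \<Rightarrow> complex measure \<Rightarrow> ereal" where
  "energy Q \<mu> = ereal (\<integral>x. Q x \<partial>\<mu>) + log_energy \<mu>"

definition equilibrium :: "(complex \<Rightarrow> real) \<Rightarrow> complex measure" where
  "equilibrium Q =
     (THE \<nu>. circle_prob \<nu> \<and> (\<forall>\<mu>. circle_prob \<mu> \<longrightarrow> energy Q \<nu> \<le> energy Q \<mu>))"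


section \<open>Hilbert transform and free Fisher information\<close>

text \<open>
  The integral runs over the interval \<open>[x - \<pi>, x + \<pi>]\<close> of length \<open>2 \<pi>\<close>, with the symmetric
  neighbourhood \<open>(x - \<epsilon>, x + \<epsilon>)\<close> of the singularity removed.
\<close>

definition circle_hilbert :: "complex measure \<Rightarrow> complex \<Rightarrow> real" where
  "circle_hilbert \<mu> z = (let x = Arg z in
     Lim (at_right 0) (\<lambda>\<epsilon>::real.
       (LINT y:{x - pi..x + pi} - {x - \<epsilon><..<x + \<epsilon>}|lborel.
          cot ((x - y) / 2) * smooth_density \<mu> (cis y) / (2 * pi))))"

definition fisher_info :: "(complex \<Rightarrow> real) \<Rightarrow> complex measure \<Rightarrow> real" where
  "fisher_info Q \<mu> =
     (\<integral>z. (circle_hilbert \<mu> z - circle_deriv Q z)\<^sup>2 \<partial>\<mu>) - (\<integral>z. circle_deriv Q z \<partial>\<mu>)\<^sup>2"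


section \<open>Wasserstein distances\<close>

definition couplings :: "real measure \<Rightarrow> real measure \<Rightarrow> (real \<times> real) measure set" where
  "couplings \<mu> \<nu> =
     {\<pi>. sets \<pi> = sets (borel \<Otimes>\<^sub>M borel) \<and> distr \<pi> borel fst = \<mu> \<and> distr \<pi> borel snd = \<nu>}"

definition ennreal_root :: "real \<Rightarrow> ennreal \<Rightarrow> ennreal" where
  "ennreal_root p c = (if c = \<infinity> then \<infinity> else ennreal (enn2real c powr (1 / p)))"

definition wasserstein :: "real \<Rightarrow> real measure \<Rightarrow> real measure \<Rightarrow> ennreal" where
  "wasserstein p \<mu> \<nu> =
     ennreal_root p (INF \<pi>\<in>couplings \<mu> \<nu>. \<integral>\<^sup>+ (x, y). ennreal (\<bar>x - y\<bar> powr p) \<partial>\<pi>)"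

definition circle_lift :: "complex measure \<Rightarrow> real measure" where
  "circle_lift \<mu> = measure_of UNIV (sets borel)
     (\<lambda>A. \<Sum>\<^sub>\<infinity>n\<in>(UNIV :: int set).
        emeasure \<mu> (cis ` (A \<inter> {2 * of_int n * pi..<2 * (of_int n + 1) * pi})))"

definition circle_window :: "complex measure \<Rightarrow> real \<Rightarrow> real measure" where
  "circle_window \<mu> u = density (circle_lift \<mu>) (indicator {u..<u + 2 * pi})"

text \<open>The supremum of the empty set is \<open>\<infinity>\<close> by convention, whereas \<open>Sup {} = 0\<close> on \<^typ>\<open>ennreal\<close>.\<close>

definition circle_wasserstein :: "real \<Rightarrow> complex measure \<Rightarrow> complex measure \<Rightarrow> ennreal" where
  "circle_wasserstein p \<mu> \<nu> =
     (let S = {wasserstein p (circle_window \<mu> u) (circle_window \<nu> v) | u v.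
                 u \<in> {0..2 * pi} \<and> v \<in> {0..2 * pi} \<and>
                 (\<integral>x. x \<partial>circle_window \<mu> u) = (\<integral>x. x \<partial>circle_window \<nu> v)}
      in if S = {} then \<infinity> else Sup S)"


section \<open>The inequalities\<close>

text \<open>
  All inequalities are between extended reals. For smooth \<open>\<mu>\<close> and continuous \<open>Q\<close> every term is
  finite, so no expression of the form \<open>\<infinity> - \<infinity>\<close> occurs.
\<close>

definition W2 :: "(complex \<Rightarrow> real) \<Rightarrow> complex measure \<Rightarrow> ereal" where
  "W2 Q \<mu> = enn2ereal (circle_wasserstein 2 \<mu> (equilibrium Q))"

definition satisfies_T :: "(complex \<Rightarrow> real) \<Rightarrow> real \<Rightarrow> bool" where
  "satisfies_T Q \<rho> \<longleftrightarrow> \<rho> > 0 \<and>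
     (\<forall>\<mu>. smooth_circle_prob \<mu> \<longrightarrow>
        ereal \<rho> * (W2 Q \<mu>)\<^sup>2 \<le> energy Q \<mu> - energy Q (equilibrium Q))"

definition satisfies_LSI :: "(complex \<Rightarrow> real) \<Rightarrow> real \<Rightarrow> bool" where
  "satisfies_LSI Q \<rho> \<longleftrightarrow> \<rho> > 0 \<and>
     (\<forall>\<mu>. smooth_circle_prob \<mu> \<longrightarrow>
        energy Q \<mu> - energy Q (equilibrium Q) \<le> ereal (1 / (4 * \<rho>) * fisher_info Q \<mu>))"

definition satisfies_HWI :: "(complex \<Rightarrow> real) \<Rightarrow> real \<Rightarrow> bool" where
  "satisfies_HWI Q \<rho> \<longleftrightarrow>
     (\<forall>\<mu>. smooth_circle_prob \<mu> \<longrightarrow>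
        energy Q \<mu> - energy Q (equilibrium Q)
          \<le> ereal (sqrt (fisher_info Q \<mu>)) * W2 Q \<mu> - ereal \<rho> * (W2 Q \<mu>)\<^sup>2)"

definition LSI_const :: "real \<Rightarrow> real \<Rightarrow> real" where
  "LSI_const C \<rho> =
     (if \<rho> \<le> 0 then (C + \<rho>)\<^sup>2 / (4 * C)
      else if \<rho> > C then \<rho>
      else (C + \<rho>)\<^sup>2 / (4 * C))"

end

theory Submission
  imports Defs
begin

text \<open>
  Granted \<open>W\<^sub>2 < \<infinity>\<close> and \<open>I\<^sub>Q \<ge> 0\<close>, both implications are elementary: (1) maximises
  \<open>sqrt I * w - \<rho> * w\<^sup>2\<close> over all \<open>w\<close>, and (2) restricts \<open>w\<close> to \<open>C * w\<^sup>2 \<le> E\<^sub>Q \<mu> - E\<^sub>Q \<mu>\<^sub>Q\<close>.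

  Finiteness of \<open>W\<^sub>2\<close> requires that the equilibrium measure really is a probability measure on the
  circle, i.e. that the minimiser exists and is unique. Abel summation of
  \<open>- ln \<bar>1 - w\<bar> = (\<Sum>k. Re (w ^ k) / k)\<close> turns the logarithmic energy of \<open>\<mu>\<close> into
  \<open>\<Sum>k. \<bar>c\<^sub>k\<bar>\<^sup>2 / k\<close>, where \<open>c\<^sub>k\<close> are the Fourier coefficients of \<open>\<mu>\<close>; this form is lower semicontinuous
  and strictly convex. The means of the windows of \<open>\<mu>\<close> vary continuously over an interval of length
  \<open>2 * \<pi>\<close> when \<open>\<mu>\<close> has no atoms, so that windows with equal means exist.

  \<open>I\<^sub>Q \<mu>\<close> is the variance of \<open>H \<mu> - Q'\<close> under \<open>\<mu>\<close>, because \<open>\<integral> H \<mu> d\<mu> = 0\<close>.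
\<close>

section \<open>Measures on the circle\<close>

text \<open>Finiteness of \<open>W2\<close> is the crux because of extended-real arithmetic. If
  \<open>W2 Q \<mu>\<close> were \<infinity>, \<open>fisher_info Q \<mu>\<close> positive and \<rho>
  > 0, the right side of HWI would read \<infinity> - \<infinity>, which evaluates to \<infinity>,
  so HWI would say nothing about the energy. Since \<open>equilibrium\<close> is a definite
  description, nothing is known about its windows before a unique minimiser is found. The sign of I
  matters because \<open>sqrt\<close> is an odd function here, so squaring \<open>sqrt i\<close>
  returns \<open>i\<close> only for \<open>0 \<le> i\<close>. The constant in (2): let d be the
  energy gap, w the distance and s = d / w^2. HWI gives I \<ge> (s + \<rho>)^2 * w^2, hence I / d
  \<ge> (s + \<rho>)^2 / s, while T says s \<ge> C > -\<rho>. The derivative of this quotient in s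
  has the sign of (s + \<rho>) * (s - \<rho>). So 4 K is its minimum over s \<ge> C, attained at s =
  C if \<rho> \<le> C, and at s = \<rho> with value 4 \<rho> otherwise.\<close>

lemma borel_measurable_Arg2pi [measurable]: "Arg2pi \<in> borel_measurable borel"
  using open_Arg2pi2pi_gt by (intro borel_measurableI_greater) auto

lemma borel_measurable_cnj [measurable]: "cnj \<in> borel_measurable borel"
  by (intro borel_measurable_continuous_onI continuous_intros)

text \<open>Differentiability concerns the curve \<open>w * cis t\<close> only, whereas continuity
  concerns all points of the circle near w. The two are linked by the local inverse z to
  \<open>Arg (z * cnj w)\<close> of the curve, which is continuous at w because \<open>Arg\<close>
  is continuous at 1.\<close>

lemma circle_differentiable_imp_continuous:
  assumes "circle_differentiable f"
  shows "continuous_on circle f"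
  unfolding continuous_on_def
proof
  fix w assume w: "w \<in> circle"
  let ?g = "\<lambda>t. f (w * cis t)"
  have "isCont ?g 0"
    using assms w by (auto simp: circle_differentiable_def intro: differentiable_imp_continuous_within)
  have w1: "w * cnj w = 1"
    using w by (simp add: complex_norm_square[symmetric])
  have "isCont Arg 1"
    by (rule continuous_at_Arg) simp
  then have A: "((\<lambda>z. Arg (z * cnj w)) \<longlongrightarrow> 0) (at w within circle)"
    using isCont_tendsto_compose[of 1 Arg "\<lambda>z. z * cnj w" "at w within circle"] w1
    by (auto intro!: tendsto_eq_intros)
  have "((\<lambda>z. ?g (Arg (z * cnj w))) \<longlongrightarrow> f w) (at w within circle)"
    using isCont_tendsto_compose[OF \<open>isCont ?g 0\<close> A] by simp
  moreover have "?g (Arg (z * cnj w)) = f z" if "z \<in> circle" for z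
  proof -
    have "cmod (z * cnj w) = 1"
      using that w by (simp add: norm_mult)
    then have "cis (Arg (z * cnj w)) = z * cnj w"
      by (subst cis_Arg) (auto simp: sgn_eq)
    moreover have "w * (z * cnj w) = z"
      using w1 by (metis mult.left_commute mult.right_neutral)
    ultimately show ?thesis
      by (simp only:)
  qed
  ultimately show "(f \<longlongrightarrow> f w) (at w within circle)"
    by (elim Lim_transform_eventually) (auto simp: eventually_at_filter)
qed

lemma cis_Arg2pi: "z \<in> circle \<Longrightarrow> cis (Arg2pi z) = z"
  using complex_norm_eq_1_exp[of z] by (simp add: cis_conv_exp)

lemma Arg2pi_cis: "0 \<le> x \<Longrightarrow> x < 2 * pi \<Longrightarrow> Arg2pi (cis x) = x"
  by (simp add: Arg2pi_exp cis_conv_exp)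

lemma measurable_circleI:
  assumes "f \<in> borel_measurable M" "\<And>x. x \<in> space M \<Longrightarrow> f x \<in> circle"
  shows "f \<in> measurable M circle_borel"
  using assms by (intro measurable_restrict_space2) auto

lemma measurable_cis_circle [measurable]: "cis \<in> measurable borel circle_borel"
  by (intro measurable_circleI borel_measurable_continuous_onI continuous_on_cis continuous_on_id) auto

section \<open>Fourier coefficients and the regularised logarithmic kernel\<close>

definition fourier :: "complex measure \<Rightarrow> nat \<Rightarrow> complex" where
  "fourier \<mu> k = (\<integral>z. z ^ k \<partial>\<mu>)"

text \<open>Division by zero makes the value at \<open>k = 0\<close> vanish, so all sums over k may
  start at 0 although the zeroth Fourier coefficient of a probability measure is 1.\<close>

definition energy_coeff :: "complex measure \<Rightarrow> nat \<Rightarrow> real" where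
  "energy_coeff \<mu> k = (cmod (fourier \<mu> k))\<^sup>2 / real k"

context
  fixes \<mu> :: "complex measure"
  assumes \<mu>: "circle_prob \<mu>"
begin

interpretation prob_space \<mu>
  using \<mu> by (simp add: circle_prob_def)

interpretation P: pair_prob_space \<mu> \<mu> ..

lemma sets_circle_prob [measurable_cong]: "sets \<mu> = sets circle_borel"
  using \<mu> by (simp add: circle_prob_def)

lemma space_circle_prob: "space \<mu> = circle"
  using sets_eq_imp_space_eq[OF sets_circle_prob] by (simp add: space_restrict_space)

lemma circle_prob_ident_measurable: "(\<lambda>x. x) \<in> borel_measurable \<mu>"
  by (subst measurable_cong_sets[OF sets_circle_prob refl]) (rule measurable_restrict_space1, simp)

lemma circle_prob_pair_measurable [measurable]:
  "fst \<in> borel_measurable (\<mu> \<Otimes>\<^sub>M \<mu>)" "snd \<in> borel_measurable (\<mu> \<Otimes>\<^sub>M \<mu>)"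
  using measurable_compose[OF measurable_fst circle_prob_ident_measurable]
    measurable_compose[OF measurable_snd circle_prob_ident_measurable] by auto

lemma circle_prob_measurable:
  assumes "continuous_on circle f"
  shows "f \<in> borel_measurable \<mu>"
  using borel_measurable_continuous_on_restrict[OF assms]
  by (subst measurable_cong_sets[OF sets_circle_prob refl])

lemma circle_prob_integrable:
  fixes f :: "complex \<Rightarrow> 'a::{banach, second_countable_topology}"
  assumes "continuous_on circle f"
  shows "integrable \<mu> f"
proof -
  have "compact (f ` circle)"
    by (intro compact_continuous_image assms) auto
  then obtain B where "\<And>z. z \<in> circle \<Longrightarrow> norm (f z) \<le> B"
    using compact_imp_bounded bounded_iff by (metis imageI)
  then show ?thesis
    by (intro integrable_const_bound[of _ B] circle_prob_measurable assms)
      (auto simp: space_circle_prob)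
qed

lemma integral_fourier_product:
  "(\<integral>p. (fst p * cnj (snd p)) ^ k \<partial>(\<mu> \<Otimes>\<^sub>M \<mu>)) = of_real ((cmod (fourier \<mu> k))\<^sup>2)"
proof -
  have "integrable (\<mu> \<Otimes>\<^sub>M \<mu>) (\<lambda>p. (fst p * cnj (snd p)) ^ k)"
    by (rule P.integrable_const_bound[of _ 1])
      (auto simp: space_pair_measure space_circle_prob norm_mult norm_power)
  then have "(\<integral>p. (fst p * cnj (snd p)) ^ k \<partial>(\<mu> \<Otimes>\<^sub>M \<mu>)) = (\<integral>x. (\<integral>y. (x * cnj y) ^ k \<partial>\<mu>) \<partial>\<mu>)"
    by (subst P.integral_fst'[symmetric]) auto
  also have "\<dots> = (\<integral>x. x ^ k * cnj (fourier \<mu> k) \<partial>\<mu>)"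
    by (simp add: fourier_def power_mult_distrib flip: complex_cnj_power)
  also have "\<dots> = fourier \<mu> k * cnj (fourier \<mu> k)"
    by (simp add: fourier_def)
  also have "\<dots> = of_real ((cmod (fourier \<mu> k))\<^sup>2)"
    by (metis complex_norm_square)
  finally show ?thesis .
qed

text \<open>For r < 1 the logarithm stays away from its singularity on the diagonal, and its power
  series is dominated by the geometric series of r, uniformly in the two points. This permits
  integration term by term, where each term separates into \<open>fourier \<mu> k\<close> and its
  conjugate.\<close>

lemma abel_kernel_sums:
  assumes r: "0 \<le> r" "r < 1"
  shows "integrable (\<mu> \<Otimes>\<^sub>M \<mu>) (\<lambda>p. - ln (cmod (1 - of_real r * (fst p * cnj (snd p)))))" (is "integrable ?P ?f")
    and "(\<lambda>k. r ^ k * energy_coeff \<mu> k) sums (\<integral>p. - ln (cmod (1 - of_real r * (fst p * cnj (snd p)))) \<partial>(\<mu> \<Otimes>\<^sub>M \<mu>))"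
proof -
  define g :: "nat \<Rightarrow> complex \<times> complex \<Rightarrow> real"
    where "g k p = r ^ k / real k * Re ((fst p * cnj (snd p)) ^ k)" for k p
  have g_int: "integrable ?P (g k)" and g_eq: "(\<integral>p. g k p \<partial>?P) = r ^ k * energy_coeff \<mu> k" for k
  proof -
    have "integrable ?P (\<lambda>p. (fst p * cnj (snd p)) ^ k)"
      by (rule P.integrable_const_bound[of _ 1])
        (auto simp: space_pair_measure space_circle_prob norm_mult norm_power)
    then show "integrable ?P (g k)" "(\<integral>p. g k p \<partial>?P) = r ^ k * energy_coeff \<mu> k"
      by (auto simp: g_def[abs_def] integral_fourier_product energy_coeff_def simp del: of_real_power)
  qed
  have g_le: "norm (g k p) \<le> r ^ k" if "p \<in> space ?P" for k p
  proof -
    have "\<bar>Re ((fst p * cnj (snd p)) ^ k)\<bar> \<le> 1"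
      using abs_Re_le_cmod[of "(fst p * cnj (snd p)) ^ k"] that
      by (auto simp: space_pair_measure space_circle_prob norm_mult norm_power)
    moreover have "r ^ k / real k \<le> r ^ k"
      using r divide_left_mono[of 1 "real k" "r ^ k"] by (cases "k = 0") auto
    ultimately have "r ^ k / real k * \<bar>Re ((fst p * cnj (snd p)) ^ k)\<bar> \<le> r ^ k * 1"
      using r by (intro mult_mono) auto
    then show ?thesis
      using r by (simp add: g_def abs_mult)
  qed
  have sums: "(\<lambda>k. g k p) sums ?f p" if "p \<in> space ?P" for p
  proof -
    let ?w = "of_real r * (fst p * cnj (snd p))"
    have w: "cmod ?w < 1"
      using that r by (auto simp: space_pair_measure space_circle_prob norm_mult)
    \<comment> \<open>The term at \<open>k = 0\<close> is 1 / 0 = 0, in agreement with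
      \<open>energy_coeff \<mu> 0 = 0\<close>.\<close>
    then have "(\<lambda>k. ?w ^ k / of_nat k) sums - Ln (1 - ?w)"
      using sums_minus[OF Ln_series'[of "- ?w"]] by simp
    then have "(\<lambda>k. Re (?w ^ k / of_nat k)) sums Re (- Ln (1 - ?w))"
      by (rule sums_Re)
    moreover have "1 - ?w \<noteq> 0"
      using w by auto
    moreover have "Re (?w ^ k / of_nat k) = g k p" for k
      by (simp add: g_def power_mult_distrib flip: of_real_power)
    ultimately show ?thesis
      by simp
  qed
  have sm: "AE p in ?P. summable (\<lambda>k. norm (g k p))"
  proof (intro AE_I2 summable_comparison_test'[OF summable_geometric[of r], of 0])
    show "norm (norm (g k p)) \<le> r ^ k" if "p \<in> space ?P" for k p
      using g_le[OF that] by simp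
  qed (use r in auto)
  have "(\<integral>p. norm (g k p) \<partial>?P) \<le> r ^ k" for k
    using g_le by (intro P.integral_le_const integrable_norm g_int AE_I2)
  moreover have "0 \<le> (\<integral>p. norm (g k p) \<partial>?P)" for k
    by (rule integral_nonneg_AE) simp
  ultimately have si: "summable (\<lambda>k. \<integral>p. norm (g k p) \<partial>?P)"
    using r by (intro summable_comparison_test'[OF summable_geometric[of r], of 0]) (simp_all only: real_norm_def abs_of_nonneg)
  have eq: "(\<Sum>k. g k p) = ?f p" if "p \<in> space ?P" for p
    using sums[OF that] by (rule sums_unique[symmetric])
  show "integrable ?P ?f"
    using integrable_suminf[OF g_int sm si] eq by (simp cong: Bochner_Integration.integrable_cong)
  show "(\<lambda>k. r ^ k * energy_coeff \<mu> k) sums (\<integral>p. ?f p \<partial>?P)"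
    using sums_integral[OF g_int sm si] eq by (simp add: g_eq cong: Bochner_Integration.integral_cong)
qed

end

section \<open>Logarithmic energy in terms of Fourier coefficients\<close>

lemma dist_circle:
  assumes "x \<in> circle" "y \<in> circle"
  shows "dist x y = cmod (1 - x * cnj y)"
proof -
  have "cmod y = 1" "y * cnj y = 1"
    using assms by (auto simp: complex_norm_square[symmetric])
  then have "dist x y = cmod ((x - y) * cnj y)"
    by (simp add: dist_norm norm_mult)
  also have "(x - y) * cnj y = x * cnj y - 1"
    by (simp add: left_diff_distrib \<open>y * cnj y = 1\<close>)
  finally show ?thesis
    by (simp add: norm_minus_commute)
qed

text \<open>These bounds control the limit r to 1. The first keeps the argument of the logarithm
  positive, the second makes the kernel non-negative after adding \<open>ln 2\<close>, and the third
  provides a majorant: moving from w to r * w costs at most 1 - r, which the first bound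
  absorbs.\<close>

lemma abel_dist_bounds:
  fixes w :: complex
  assumes "cmod w = 1" "0 \<le> r" "r < 1"
  shows "1 - r \<le> cmod (1 - of_real r * w)" "cmod (1 - of_real r * w) \<le> 2"
    "cmod (1 - w) \<le> 2 * cmod (1 - of_real r * w)"
proof -
  have *: "cmod (of_real r * w) = r"
    using assms by (simp add: norm_mult)
  show 1: "1 - r \<le> cmod (1 - of_real r * w)"
    using norm_triangle_ineq2[of 1 "of_real r * w"] * by simp
  show "cmod (1 - of_real r * w) \<le> 2"
    using norm_triangle_ineq4[of 1 "of_real r * w"] * assms by simp
  have "1 - w = (1 - of_real r * w) - of_real (1 - r) * w"
    by (simp add: algebra_simps)
  then have "cmod (1 - w) \<le> cmod (1 - of_real r * w) + cmod (of_real (1 - r) * w)"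
    by (metis norm_triangle_ineq4)
  also have "cmod (of_real (1 - r) * w) = 1 - r"
    using assms by (simp add: norm_mult del: of_real_diff)
  finally show "cmod (1 - w) \<le> 2 * cmod (1 - of_real r * w)"
    using 1 by simp
qed

text \<open>Abel summation with non-negative terms is monotone convergence for the counting measure,
  and therefore includes the case of a divergent series.\<close>

lemma ennreal_suminf_power_LIMSEQ:
  fixes a :: "nat \<Rightarrow> real"
  assumes r: "incseq r" "\<And>n. 0 \<le> r n" "r \<longlonglongrightarrow> 1" and a: "\<And>k. 0 \<le> a k"
  shows "(\<lambda>n. \<Sum>k. ennreal (r n ^ k * a k)) \<longlonglongrightarrow> (\<Sum>k. ennreal (a k))"
proof -
  have inc: "incseq (\<lambda>n. ennreal (r n ^ k * a k))" for k
    using r a by (intro monoI ennreal_leI mult_right_mono power_mono) (auto dest: incseqD)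
  have "(\<lambda>n. r n ^ k * a k) \<longlonglongrightarrow> 1 ^ k * a k" for k
    using r by (intro tendsto_intros)
  then have sup: "(SUP n. ennreal (r n ^ k * a k)) = ennreal (a k)" for k
    using LIMSEQ_unique[OF LIMSEQ_SUP[OF inc] tendsto_ennrealI] by fastforce
  have "(\<Sum>k. ennreal (a k)) = (\<integral>\<^sup>+k. (SUP n. ennreal (r n ^ k * a k)) \<partial>count_space UNIV)"
    by (simp add: nn_integral_count_space_nat sup)
  also have "\<dots> = (SUP n. \<integral>\<^sup>+k. ennreal (r n ^ k * a k) \<partial>count_space UNIV)"
    using inc by (intro nn_integral_monotone_convergence_SUP) (auto simp: incseq_def le_fun_def)
  also have "\<dots> = (SUP n. \<Sum>k. ennreal (r n ^ k * a k))"
    by (simp add: nn_integral_count_space_nat)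
  finally show ?thesis
    using inc by (auto intro!: LIMSEQ_SUP suminf_le monoI simp: incseq_def)
qed

lemma energy_coeff_nonneg: "0 \<le> energy_coeff \<mu> k"
  by (simp add: energy_coeff_def)

context
  fixes \<mu> :: "complex measure"
  assumes \<mu>: "circle_prob \<mu>"
begin

interpretation prob_space \<mu>
  using \<mu> by (simp add: circle_prob_def)

interpretation P: pair_prob_space \<mu> \<mu> ..

declare circle_prob_pair_measurable[OF \<mu>, measurable]

text \<open>The shift by \<open>ln 2\<close> makes the kernel non-negative, since two points at
  distance at most 1 from the origin are at most 2 apart. The limit r to 1 can then be taken in
  \<open>ennreal\<close>, where an infinite energy is harmless.\<close>

lemma nn_integral_abel_kernel:
  assumes r: "0 \<le> r" "r < 1"
  shows "(\<integral>\<^sup>+p. ennreal (ln 2 - ln (cmod (1 - of_real r * (fst p * cnj (snd p))))) \<partial>(\<mu> \<Otimes>\<^sub>M \<mu>))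
    = ennreal (ln 2) + (\<Sum>k. ennreal (r ^ k * energy_coeff \<mu> k))"
proof -
  let ?f = "\<lambda>p. - ln (cmod (1 - of_real r * (fst p * cnj (snd p))))"
  note f = abel_kernel_sums[OF \<mu> r]
  have nn: "0 \<le> ln 2 + ?f p" if "p \<in> space (\<mu> \<Otimes>\<^sub>M \<mu>)" for p
  proof -
    have "cmod (fst p * cnj (snd p)) = 1"
      using that by (auto simp: space_pair_measure space_circle_prob[OF \<mu>] norm_mult)
    from abel_dist_bounds[OF this r] r
    have "ln (cmod (1 - of_real r * (fst p * cnj (snd p)))) \<le> ln 2"
      by (intro ln_mono) auto
    then show ?thesis
      by simp
  qed
  have "(\<integral>\<^sup>+p. ennreal (ln 2 + ?f p) \<partial>(\<mu> \<Otimes>\<^sub>M \<mu>)) = ennreal (\<integral>p. ln 2 + ?f p \<partial>(\<mu> \<Otimes>\<^sub>M \<mu>))"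
    using f nn by (intro nn_integral_eq_integral) auto
  also have "(\<integral>p. ln 2 + ?f p \<partial>(\<mu> \<Otimes>\<^sub>M \<mu>)) = ln 2 + (\<Sum>k. r ^ k * energy_coeff \<mu> k)"
    using f by (simp add: P.prob_space sums_unique Bochner_Integration.integral_minus[symmetric] del: Bochner_Integration.integral_minus)
  also have "ennreal \<dots> = ennreal (ln 2) + ennreal (\<Sum>k. r ^ k * energy_coeff \<mu> k)"
    using r f(2) by (intro ennreal_plus suminf_nonneg) (auto simp: sums_iff energy_coeff_nonneg)
  also have "ennreal (\<Sum>k. r ^ k * energy_coeff \<mu> k) = (\<Sum>k. ennreal (r ^ k * energy_coeff \<mu> k))"
    using r f(2) by (intro suminf_ennreal2[symmetric]) (auto simp: sums_iff energy_coeff_nonneg)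
  finally show ?thesis
    by simp
qed

text \<open>Fatou's lemma bounds the left side by the right side. If the left side is infinite, this
  is already equality; if it is finite, the limit kernel itself, shifted by a constant, is an
  integrable majorant and dominated convergence applies.\<close>

lemma nn_integral_log_kernel:
  "(\<integral>\<^sup>+p. (if fst p = snd p then \<infinity> else ennreal (ln 2 - ln (dist (fst p) (snd p)))) \<partial>(\<mu> \<Otimes>\<^sub>M \<mu>))
    = ennreal (ln 2) + (\<Sum>k. ennreal (energy_coeff \<mu> k))" (is "(\<integral>\<^sup>+p. ?f p \<partial>?P) = ?S")
proof -
  define r :: "nat \<Rightarrow> real" where "r n = 1 - 1 / real (Suc n)" for n
  have r: "0 \<le> r n" "r n < 1" for n
    by (auto simp: r_def)
  have r_inc: "incseq r"
    by (auto simp: r_def incseq_def intro!: divide_left_mono)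
  have r_lim: "r \<longlonglongrightarrow> 1"
    unfolding r_def using tendsto_diff[OF tendsto_const LIMSEQ_inverse_real_of_nat, of 1]
    by (simp add: inverse_eq_divide)
  define u where "u n p = ennreal (ln 2 - ln (cmod (1 - of_real (r n) * (fst p * cnj (snd p)))))"
    for n and p :: "complex \<times> complex"
  have u_meas [measurable]: "u n \<in> borel_measurable ?P" for n
    unfolding u_def[abs_def] by measurable
  have f_meas [measurable]: "?f \<in> borel_measurable ?P"
    by measurable
  have lim: "(\<lambda>n. integral\<^sup>N ?P (u n)) \<longlonglongrightarrow> ?S"
    unfolding u_def nn_integral_abel_kernel[OF r]
    by (intro tendsto_add tendsto_const ennreal_suminf_power_LIMSEQ r_inc r r_lim energy_coeff_nonneg)
  have u_lim: "(\<lambda>n. u n p) \<longlonglongrightarrow> ?f p" if "p \<in> space ?P" for p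
  proof -
    let ?w = "fst p * cnj (snd p)"
    have xy: "fst p \<in> circle" "snd p \<in> circle"
      using that by (auto simp: space_pair_measure space_circle_prob[OF \<mu>])
    show ?thesis
    proof (cases "fst p = snd p")
      case True
      \<comment> \<open>On the diagonal the regularised kernel equals
        \<open>ln 2 + ln (n + 1)\<close> and diverges, which matches the explicit value
        \<infinity>.\<close>
      then have "?w = 1"
        using xy complex_norm_square[of "snd p"] by simp
      then have "u n p = ennreal (ln 2 - ln (1 / real (Suc n)))" for n
        unfolding u_def r_def by (simp add: norm_divide del: of_nat_Suc)
      also have "\<dots> n = ennreal (ln 2 + ln (real (Suc n)))" for n
        by (simp add: ln_div del: of_nat_Suc)
      finally have u: "u n p = ennreal (ln 2 + ln (real (Suc n)))" for n .
      have "filterlim (\<lambda>n. ln 2 + ln (real (Suc n))) at_top sequentially"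
        by (intro filterlim_tendsto_add_at_top[OF tendsto_const] filterlim_compose[OF ln_at_top]
          filterlim_compose[OF filterlim_real_sequentially] filterlim_Suc)
      then show ?thesis
        unfolding u using True by (simp only: ennreal_tendsto_top_eq_at_top simp_thms if_True infinity_ennreal_def)
    next
      case False
      then have "1 - ?w \<noteq> 0"
        using dist_circle[OF xy] by (metis dist_eq_0_iff norm_eq_zero)
      then have "(\<lambda>n. u n p) \<longlonglongrightarrow> ennreal (ln 2 - ln (cmod (1 - of_real 1 * ?w)))"
        unfolding u_def by (intro tendsto_intros r_lim) auto
      then show ?thesis
        using False dist_circle[OF xy] by simp
    qed
  qed
  have "(\<integral>\<^sup>+p. ?f p \<partial>?P) = (\<integral>\<^sup>+p. liminf (\<lambda>n. u n p) \<partial>?P)"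
    using u_lim by (intro nn_integral_cong lim_imp_Liminf[symmetric]) auto
  also have "\<dots> \<le> liminf (\<lambda>n. integral\<^sup>N ?P (u n))"
    by (rule nn_integral_liminf) simp
  also have "\<dots> = ?S"
    using lim by (intro lim_imp_Liminf) auto
  finally have le: "(\<integral>\<^sup>+p. ?f p \<partial>?P) \<le> ?S" .
  show ?thesis
  proof (cases "(\<integral>\<^sup>+p. ?f p \<partial>?P) = \<infinity>")
    case True
    then show ?thesis
      using le by (simp add: top_unique)
  next
    case False
    have "(\<lambda>n. integral\<^sup>N ?P (u n)) \<longlonglongrightarrow> (\<integral>\<^sup>+p. ?f p \<partial>?P)"
    \<comment> \<open>The extra \<open>ln 2\<close> is the logarithm of the factor 2 in the last
      bound of \<open>abel_dist_bounds\<close>.\<close>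
    proof (rule nn_integral_dominated_convergence[where w="\<lambda>p. ?f p + ennreal (ln 2)"])
      show "(\<integral>\<^sup>+p. ?f p + ennreal (ln 2) \<partial>?P) < \<infinity>"
        using False by (subst nn_integral_add) (auto simp: P.emeasure_space_1 less_top)
      have "u n p \<le> ?f p + ennreal (ln 2)" if "p \<in> space ?P" for n p
      proof (cases "fst p = snd p")
        case False
        let ?w = "fst p * cnj (snd p)"
        have xy: "fst p \<in> circle" "snd p \<in> circle"
          using that by (auto simp: space_pair_measure space_circle_prob[OF \<mu>])
        have "cmod ?w = 1"
          using xy by (simp add: norm_mult)
        note b = abel_dist_bounds[OF this r, of n]
        have pos: "0 < dist (fst p) (snd p)"
          using False by simp
        then have "ln (dist (fst p) (snd p)) \<le> ln (2 * cmod (1 - of_real (r n) * ?w))"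
          using b dist_circle[OF xy] by (intro ln_mono) auto
        also have "\<dots> = ln 2 + ln (cmod (1 - of_real (r n) * ?w))"
          using b r[of n] by (intro ln_mult_pos) auto
        finally have 1: "ln 2 - ln (cmod (1 - of_real (r n) * ?w)) \<le> (ln 2 - ln (dist (fst p) (snd p))) + ln 2"
          by simp
        have "dist (fst p) (snd p) \<le> 2"
          using xy norm_triangle_ineq4[of "fst p" "snd p"] by (simp add: dist_norm)
        then have "0 \<le> ln 2 - ln (dist (fst p) (snd p))"
          using pos by simp
        then show ?thesis
          using 1 False by (simp add: u_def ennreal_leI flip: ennreal_plus)
      qed simp
      then show "AE p in ?P. u n p \<le> ?f p + ennreal (ln 2)" for n
        by (intro AE_I2)
    qed (use u_lim in auto)
    with lim show ?thesis
      by (rule LIMSEQ_unique[symmetric])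
  qed
qed

text \<open>The definition splits the kernel into positive and negative part, while the series was
  computed for the kernel shifted by \<open>ln 2\<close>. Adding the negative part on both sides
  reconciles the two inside \<open>ennreal\<close>; as \<open>ln 2\<close> and the negative part
  have finite integrals, both can be cancelled.\<close>

lemma log_energy_eq: "log_energy \<mu> = enn2ereal (\<Sum>k. ennreal (energy_coeff \<mu> k))"
proof -
  let ?P = "\<mu> \<Otimes>\<^sub>M \<mu>"
  let ?f = "\<lambda>p. if fst p = snd p then \<infinity> else ennreal (ln 2 - ln (dist (fst p) (snd p)))"
  let ?g = "\<lambda>p. if fst p = snd p then \<infinity> else ennreal (- ln (dist (fst p) (snd p)))"
  let ?h = "\<lambda>p. ennreal (ln (dist (fst p) (snd p)))"
  have d: "dist (fst p) (snd p) \<le> 2" if "p \<in> space ?P" for p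
    using that norm_triangle_ineq4[of "fst p" "snd p"]
    by (auto simp: dist_norm space_pair_measure space_circle_prob[OF \<mu>])
  have "?f p + ?h p = ?g p + ennreal (ln 2)" if "p \<in> space ?P" for p
  proof (cases "fst p = snd p")
    case False
    with d[OF that] have "ln (dist (fst p) (snd p)) \<le> ln 2"
      by simp
    then show ?thesis
      using False by (cases "ln (dist (fst p) (snd p)) \<ge> 0") (simp_all add: ennreal_neg flip: ennreal_plus)
  qed simp
  then have "(\<integral>\<^sup>+p. ?f p + ?h p \<partial>?P) = (\<integral>\<^sup>+p. ?g p + ennreal (ln 2) \<partial>?P)"
    by (rule nn_integral_cong)
  then have "ennreal (ln 2) + ((\<Sum>k. ennreal (energy_coeff \<mu> k)) + (\<integral>\<^sup>+p. ?h p \<partial>?P)) = ennreal (ln 2) + (\<integral>\<^sup>+p. ?g p \<partial>?P)"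
    by (simp add: nn_integral_add nn_integral_log_kernel P.emeasure_space_1 ac_simps)
  then have g: "(\<integral>\<^sup>+p. ?g p \<partial>?P) = (\<Sum>k. ennreal (energy_coeff \<mu> k)) + (\<integral>\<^sup>+p. ?h p \<partial>?P)"
    unfolding ennreal_add_left_cancel by simp
  have "(\<integral>\<^sup>+p. ?h p \<partial>?P) \<le> (\<integral>\<^sup>+p. ennreal (ln 2) \<partial>?P)"
  proof (intro nn_integral_mono ennreal_leI)
    fix p assume "p \<in> space ?P"
    from d[OF this] show "ln (dist (fst p) (snd p)) \<le> ln 2"
      by (cases "dist (fst p) (snd p) = 0") auto
  qed
  then have "(\<integral>\<^sup>+p. ?h p \<partial>?P) \<noteq> \<infinity>"
    by (auto simp: P.emeasure_space_1 top_unique)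
  then obtain h where "(\<integral>\<^sup>+p. ?h p \<partial>?P) = ennreal h" "0 \<le> h"
    by (cases "\<integral>\<^sup>+p. ?h p \<partial>?P") auto
  then show ?thesis
    unfolding log_energy_def case_prod_beta g plus_ennreal.rep_eq
    by (cases "enn2ereal (\<Sum>k. ennreal (energy_coeff \<mu> k))") (auto simp: enn2ereal_ennreal)
qed

text \<open>This replaces an extended-real energy by finite partial sums. Lower semicontinuity and
  strict convexity then only have to be checked on finitely many Fourier coefficients at a
  time.\<close>

lemma energy_le_iff:
  "energy Q \<mu> \<le> ereal e \<longleftrightarrow> (\<forall>n. (\<integral>z. Q z \<partial>\<mu>) + (\<Sum>k<n. energy_coeff \<mu> k) \<le> e)"
proof -
  let ?q = "\<integral>z. Q z \<partial>\<mu>"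
  have "energy Q \<mu> \<le> ereal e \<longleftrightarrow> enn2ereal (\<Sum>k. ennreal (energy_coeff \<mu> k)) \<le> ereal (e - ?q)"
    unfolding energy_def log_energy_eq
    by (cases "enn2ereal (\<Sum>k. ennreal (energy_coeff \<mu> k))") auto
  also have "\<dots> \<longleftrightarrow> (\<forall>n. (\<Sum>k<n. energy_coeff \<mu> k) \<le> e - ?q)"
  proof (cases "e - ?q \<ge> 0")
    case True
    have "enn2ereal (\<Sum>k. ennreal (energy_coeff \<mu> k)) \<le> ereal (e - ?q)
        \<longleftrightarrow> (\<Sum>k. ennreal (energy_coeff \<mu> k)) \<le> ennreal (e - ?q)"
      using True by (metis enn2ereal_ennreal less_eq_ennreal.rep_eq)
    also have "\<dots> \<longleftrightarrow> (\<forall>n. (\<Sum>k<n. ennreal (energy_coeff \<mu> k)) \<le> ennreal (e - ?q))"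
      by (auto simp: suminf_eq_SUP SUP_le_iff)
    also have "\<dots> \<longleftrightarrow> (\<forall>n. (\<Sum>k<n. energy_coeff \<mu> k) \<le> e - ?q)"
      using True by (simp add: sum_ennreal energy_coeff_nonneg)
    finally show ?thesis .
  next
    case False
    then have "\<not> enn2ereal (\<Sum>k. ennreal (energy_coeff \<mu> k)) \<le> ereal (e - ?q)"
      by (metis enn2ereal_nonneg ereal_less_eq(5) order_trans)
    \<comment> \<open>The empty partial sum already violates the right side.\<close>
    moreover have "\<not> (\<Sum>k<0::nat. energy_coeff \<mu> k) \<le> e - ?q"
      using False by simp
    ultimately show ?thesis
      by blast
  qed
  finally show ?thesis
    by (simp add: le_diff_eq add.commute)
qed

end

section \<open>Haar measure, midpoints and weak limits\<close>

lemma circle_prob_space: "circle_prob \<mu> \<Longrightarrow> prob_space \<mu>"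
  by (simp add: circle_prob_def)

lemma circle_prob_distr:
  assumes "prob_space M" "f \<in> measurable M circle_borel"
  shows "circle_prob (distr M circle_borel f)"
  using assms by (auto simp: circle_prob_def intro: prob_space.prob_space_distr)

lemma circle_prob_haar: "circle_prob circle_haar"
  unfolding circle_haar_def
  by (intro circle_prob_distr prob_space_uniform_measure)
    (auto simp: emeasure_lborel_Ico uniform_measure_def)

lemma continuous_on_circle_cis:
  assumes "continuous_on circle f"
  shows "continuous_on A (\<lambda>x. f (cis x))"
  by (rule continuous_on_compose2[OF assms]) (auto intro!: continuous_intros continuous_on_cis)

text \<open>The target is the gauge integral over a closed interval, where shifting and splitting
  the interval are directly available. The endpoint \<open>2 * pi\<close> is a null set.\<close>

lemma integral_circle_haar:
  fixes f :: "complex \<Rightarrow> 'a::euclidean_space"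
  assumes f: "continuous_on circle f"
  shows "(\<integral>z. f z \<partial>circle_haar) = integral {0..2*pi} (\<lambda>x. f (cis x)) /\<^sub>R (2 * pi)"
proof -
  have fm: "f \<in> borel_measurable circle_borel"
    by (rule borel_measurable_continuous_on_restrict[OF f])
  have g: "(\<lambda>x. f (cis x)) \<in> borel_measurable borel"
    by (intro borel_measurable_continuous_onI continuous_on_circle_cis f)
  have "(\<integral>z. f z \<partial>circle_haar) = (\<integral>x. f (cis x) \<partial>uniform_measure lborel {0..<2*pi})"
    unfolding circle_haar_def by (rule integral_distr[OF _ fm]) (simp add: uniform_measure_def)
  also have "\<dots> = (\<integral>x. f (cis x) \<partial>density lborel (\<lambda>x. ennreal (indicator {0..<2*pi} x / (2 * pi))))"
    unfolding uniform_measure_def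
    by (intro arg_cong2[where f="integral\<^sup>L"] arg_cong2[where f=density] refl ext)
      (auto simp: indicator_def emeasure_lborel_Ico divide_ennreal simp flip: ennreal_1)
  also have "\<dots> = (\<integral>x. (indicator {0..<2*pi} x / (2 * pi)) *\<^sub>R f (cis x) \<partial>lborel)"
    using g by (intro integral_density) auto
  also have "\<dots> = (\<integral>x. indicator {0..2*pi} x *\<^sub>R f (cis x) /\<^sub>R (2 * pi) \<partial>lborel)"
  proof (rule integral_cong_AE)
    show "AE x in lborel. (indicator {0..<2*pi} x / (2 * pi)) *\<^sub>R f (cis x) = indicator {0..2*pi} x *\<^sub>R f (cis x) /\<^sub>R (2 * pi)"
      using AE_lborel_singleton[of "2*pi"]
      by eventually_elim (auto simp: indicator_def inverse_eq_divide)
  qed (use g in auto)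
  also have "\<dots> = (LINT x:{0..2*pi}|lborel. f (cis x)) /\<^sub>R (2 * pi)"
    by (simp only: set_lebesgue_integral_def integral_scaleR_right)
  also have "(LINT x:{0..2*pi}|lborel. f (cis x)) = integral {0..2*pi} (\<lambda>x. f (cis x))"
    by (intro set_borel_integral_eq_integral borel_integrable_atLeastAtMost' continuous_on_circle_cis f)
  finally show ?thesis .
qed

lemma continuous_on_circle_mult:
  assumes "continuous_on circle f" "w \<in> circle"
  shows "continuous_on circle (\<lambda>z. f (w * z))"
  using assms by (intro continuous_on_compose2[OF assms(1)] continuous_intros) (auto simp: norm_mult)

lemma integral_circle_haar_rotate:
  fixes f :: "complex \<Rightarrow> 'a::euclidean_space"
  assumes f: "continuous_on circle f" and w: "w \<in> circle"
  shows "(\<integral>z. f (w * z) \<partial>circle_haar) = (\<integral>z. f z \<partial>circle_haar)"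
proof -
  define s where "s = Arg2pi w"
  have s: "0 \<le> s" "s \<le> 2 * pi" "w = cis s"
    using Arg2pi[of w] cis_Arg2pi[OF w] by (auto simp: s_def)
  let ?g = "\<lambda>x. f (cis x)"
  have int: "?g integrable_on {a..b}" for a b
    by (intro integrable_continuous_real continuous_on_circle_cis f)
  have "integral {0..2*pi} (\<lambda>x. f (w * cis x)) = integral {0..2*pi} (?g \<circ> (+) s)"
    by (simp add: s cis_mult o_def)
  also have "\<dots> = integral {s..2*pi + s} ?g"
    by (subst integral_shift_Icc_real) simp
  \<comment> \<open>The part of the shifted interval beyond \<open>2 * pi\<close> is cut off and
    moved back by periodicity.\<close>
  also have "\<dots> = integral {s..2*pi} ?g + integral {2*pi..2*pi + s} ?g"
    using s int by (intro Henstock_Kurzweil_Integration.integral_combine[symmetric]) auto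
  also have "integral {2*pi..2*pi + s} ?g = integral {0..s} (?g \<circ> (+) (2*pi))"
    by (subst integral_shift_Icc_real) (simp add: add.commute)
  also have "?g \<circ> (+) (2*pi) = ?g"
    by (auto simp: fun_eq_iff cis_mult[symmetric])
  also have "integral {s..2*pi} ?g + integral {0..s} ?g = integral {0..2*pi} ?g"
    using s int by (subst add.commute, intro Henstock_Kurzweil_Integration.integral_combine) auto
  finally show ?thesis
    using f w by (simp add: integral_circle_haar continuous_on_circle_mult)
qed

text \<open>Rotation by a point w with \<open>w ^ k = -1\<close> preserves Haar measure and changes
  the sign of the coefficient.\<close>

lemma fourier_haar:
  assumes "k > 0"
  shows "fourier circle_haar k = 0"
proof -
  define w where "w = cis (pi / real k)"
  have w: "w \<in> circle" "w ^ k = -1"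
    using assms by (auto simp: w_def Complex.DeMoivre)
  have "fourier circle_haar k = (\<integral>z. (w * z) ^ k \<partial>circle_haar)"
    unfolding fourier_def by (intro integral_circle_haar_rotate[symmetric] w continuous_intros)
  also have "\<dots> = - fourier circle_haar k"
    by (simp add: fourier_def power_mult_distrib w)
  finally show ?thesis
    by (simp add: equation_minus_iff)
qed

text \<open>Supplies a competitor of finite energy for the minimisation.\<close>

lemma energy_haar_le: "energy Q circle_haar \<le> ereal (\<integral>z. Q z \<partial>circle_haar)"
proof -
  have "energy_coeff circle_haar k = 0" for k
    by (cases "k = 0") (auto simp: energy_coeff_def fourier_haar)
  then show ?thesis
    by (simp add: energy_le_iff[OF circle_prob_haar])
qed

text \<open>The average of two laws is the law of a random choice: a fair coin selects one of two
  independent points. Complex-valued test functions serve the Fourier coefficients and, via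
  \<open>of_real\<close>, the potential.\<close>

lemma circle_prob_midpoint:
  assumes \<mu>: "circle_prob \<mu>" and \<nu>: "circle_prob \<nu>"
  obtains \<eta> where "circle_prob \<eta>"
    "\<And>f :: complex \<Rightarrow> complex. continuous_on circle f \<Longrightarrow>
      (\<integral>z. f z \<partial>\<eta>) = ((\<integral>z. f z \<partial>\<mu>) + (\<integral>z. f z \<partial>\<nu>)) / 2"
proof -
  let ?B = "measure_pmf (bernoulli_pmf (1/2))" and ?R = "\<mu> \<Otimes>\<^sub>M \<nu>"
  define T where "T = (\<lambda>p :: bool \<times> complex \<times> complex. if fst p then fst (snd p) else snd (snd p))"
  interpret \<mu>: prob_space \<mu> by (rule circle_prob_space[OF \<mu>])
  interpret \<nu>: prob_space \<nu> by (rule circle_prob_space[OF \<nu>])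
  interpret R: pair_prob_space \<mu> \<nu> ..
  interpret P: pair_prob_space ?B ?R ..
  have 1: "fst \<in> borel_measurable ?R" "snd \<in> borel_measurable ?R"
    using measurable_compose[OF measurable_fst circle_prob_ident_measurable[OF \<mu>]]
      measurable_compose[OF measurable_snd circle_prob_ident_measurable[OF \<nu>]] by auto
  have T: "T \<in> measurable (?B \<Otimes>\<^sub>M ?R) circle_borel"
  proof (rule measurable_circleI)
    show "T \<in> borel_measurable (?B \<Otimes>\<^sub>M ?R)"
      unfolding T_def
    proof (intro measurable_If)
      show "(\<lambda>p. fst (snd p)) \<in> borel_measurable (?B \<Otimes>\<^sub>M ?R)" "(\<lambda>p. snd (snd p)) \<in> borel_measurable (?B \<Otimes>\<^sub>M ?R)"
        by (rule measurable_compose[OF measurable_snd 1(1)], rule measurable_compose[OF measurable_snd 1(2)])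
      have "Measurable.pred (?B \<Otimes>\<^sub>M ?R) fst"
        using measurable_fst[of ?B ?R] by (subst (asm) measurable_cong_sets[OF refl sets_measure_pmf_count_space])
      then show "{p \<in> space (?B \<Otimes>\<^sub>M ?R). fst p} \<in> sets (?B \<Otimes>\<^sub>M ?R)"
        by (rule predE)
    qed
  qed (auto simp: T_def space_pair_measure space_circle_prob[OF \<mu>] space_circle_prob[OF \<nu>])
  show thesis
  proof (rule that)
    show "circle_prob (distr (?B \<Otimes>\<^sub>M ?R) circle_borel T)"
      by (intro circle_prob_distr P.prob_space_axioms T)
    fix f :: "complex \<Rightarrow> complex" assume f: "continuous_on circle f"
    have fm: "f \<in> borel_measurable circle_borel"
      by (rule borel_measurable_continuous_on_restrict[OF f])
    have "compact (f ` circle)"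
      by (intro compact_continuous_image f) auto
    then obtain B where B: "\<And>z. z \<in> circle \<Longrightarrow> cmod (f z) \<le> B"
      using compact_imp_bounded bounded_iff by (metis imageI)
    have mfT: "(\<lambda>p. f (T p)) \<in> borel_measurable (?B \<Otimes>\<^sub>M ?R)"
      by (rule measurable_compose[OF T fm])
    have "integrable (?B \<Otimes>\<^sub>M ?R) (\<lambda>p. f (T p))"
      using measurable_space[OF T] B mfT
      by (intro P.integrable_const_bound[of _ B]) (auto simp: space_restrict_space)
    note fub = P.integral_fst'[OF this]
    have intR: "integrable ?R (\<lambda>p. f (fst p))" "integrable ?R (\<lambda>p. f (snd p))"
      using B measurable_compose[OF measurable_fst circle_prob_measurable[OF \<mu> f]]
        measurable_compose[OF measurable_snd circle_prob_measurable[OF \<nu> f]]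
      by (auto intro!: R.integrable_const_bound[of _ B] AE_I2
        simp: space_pair_measure space_circle_prob[OF \<mu>] space_circle_prob[OF \<nu>])
    have fst: "(\<integral>p. f (fst p) \<partial>?R) = (\<integral>z. f z \<partial>\<mu>)"
      using R.integral_fst'[OF intR(1)] by (simp add: \<nu>.prob_space)
    have snd: "(\<integral>p. f (snd p) \<partial>?R) = (\<integral>z. f z \<partial>\<nu>)"
      using R.integral_fst'[OF intR(2)] by (simp add: \<mu>.prob_space)
    have "(\<integral>z. f z \<partial>distr (?B \<Otimes>\<^sub>M ?R) circle_borel T) = (\<integral>b. (\<integral>p. f (T (b, p)) \<partial>?R) \<partial>?B)"
      by (simp add: integral_distr[OF T fm] fub)
    also have "\<dots> = ((\<integral>z. f z \<partial>\<mu>) + (\<integral>z. f z \<partial>\<nu>)) / 2"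
      by (simp add: integral_measure_pmf[of UNIV] UNIV_bool T_def fst snd field_simps scaleR_conv_of_real)
    finally show "(\<integral>z. f z \<partial>distr (?B \<Otimes>\<^sub>M ?R) circle_borel T) = ((\<integral>z. f z \<partial>\<mu>) + (\<integral>z. f z \<partial>\<nu>)) / 2" .
  qed
qed

text \<open>Compactness is borrowed from the line: the laws of \<open>Arg2pi\<close> live in a fixed
  bounded interval, hence are tight. Mass may drift up to the endpoint \<open>2 * pi\<close>, where
  \<open>Arg2pi\<close> jumps, but \<open>cis\<close> sends that endpoint back to 1, and
  \<open>f (cis x)\<close> is continuous on the whole line.\<close>

lemma circle_prob_seq_compact:
  fixes \<mu> :: "nat \<Rightarrow> complex measure"
  assumes \<mu>: "\<And>n. circle_prob (\<mu> n)"
  obtains r \<nu> where "strict_mono r" "circle_prob \<nu>"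
    "\<And>f :: complex \<Rightarrow> complex. continuous_on circle f \<Longrightarrow>
      (\<lambda>n. \<integral>z. f z \<partial>\<mu> (r n)) \<longlonglongrightarrow> (\<integral>z. f z \<partial>\<nu>)"
proof -
  have A: "Arg2pi \<in> borel_measurable (\<mu> n)" for n
    by (rule measurable_compose[OF circle_prob_ident_measurable[OF \<mu>] borel_measurable_Arg2pi])
  define N where "N n = distr (\<mu> n) borel Arg2pi" for n
  have N: "real_distribution (N n)" for n
    unfolding N_def real_distribution_def real_distribution_axioms_def
    using A \<mu> by (auto intro: prob_space.prob_space_distr circle_prob_space)
  have "measure (N n) {-1<..7} = 1" for n
  proof -
    interpret real_distribution "N n" by (rule N)
    have "Arg2pi z \<in> {-1<..7}" for z
      using Arg2pi[of z] pi_less_4 pi_approx(2) by auto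
    then have "Arg2pi -` {-1<..7} \<inter> space (\<mu> n) = space (\<mu> n)"
      by auto
    then show ?thesis
      unfolding N_def using A circle_prob_space[OF \<mu>]
      by (subst measure_distr) (auto simp: prob_space.prob_space)
  qed
  then have "tight N"
    unfolding tight_def using N by (intro conjI allI impI exI[of _ "-1"] exI[of _ 7]) auto
  from tight_imp_convergent_subsubsequence[OF this strict_mono_id]
  obtain r M where r: "strict_mono r" and M: "real_distribution M" and conv: "weak_conv_m (N \<circ> r) M"
    by (auto simp: comp_def id_def)
  interpret M: real_distribution M by (rule M)
  have cis_M: "cis \<in> measurable M circle_borel"
    by measurable
  show thesis
  proof (rule that[OF r])
    show "circle_prob (distr M circle_borel cis)"
      by (intro circle_prob_distr M.prob_space_axioms cis_M)
    fix f :: "complex \<Rightarrow> complex" assume f: "continuous_on circle f"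
    have fm: "f \<in> borel_measurable circle_borel"
      by (rule borel_measurable_continuous_on_restrict[OF f])
    have "compact (f ` circle)"
      by (intro compact_continuous_image f) auto
    then obtain B where B: "\<And>z. z \<in> circle \<Longrightarrow> cmod (f z) \<le> B"
      using compact_imp_bounded bounded_iff by (metis imageI)
    have c: "continuous_on UNIV (\<lambda>x. f (cis x))"
      by (rule continuous_on_circle_cis[OF f])
    have "(\<lambda>n. \<integral>x. f (cis x) \<partial>(N \<circ> r) n) \<longlonglongrightarrow> (\<integral>x. f (cis x) \<partial>M)"
    proof (rule weak_conv_imp_integral_bdd_continuous_conv[OF _ M conv, where B=B])
      show "isCont (\<lambda>x. f (cis x)) x" for x
        using c by (simp add: continuous_on_eq_continuous_at)
    qed (use N B in auto)
    moreover have "(\<integral>x. f (cis x) \<partial>N n) = (\<integral>z. f z \<partial>\<mu> n)" for n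
    proof -
      have "(\<integral>x. f (cis x) \<partial>N n) = (\<integral>z. f (cis (Arg2pi z)) \<partial>\<mu> n)"
        unfolding N_def using A c by (intro integral_distr borel_measurable_continuous_onI) auto
      also have "\<dots> = (\<integral>z. f z \<partial>\<mu> n)"
        using cis_Arg2pi by (intro Bochner_Integration.integral_cong) (auto simp: space_circle_prob[OF \<mu>])
      finally show ?thesis .
    qed
    ultimately show "(\<lambda>n. \<integral>z. f z \<partial>\<mu> (r n)) \<longlonglongrightarrow> (\<integral>z. f z \<partial>distr M circle_borel cis)"
      by (simp add: integral_distr[OF cis_M fm])
  qed
qed

section \<open>Existence and uniqueness of the equilibrium measure\<close>

lemma moment_circle_prob:
  assumes \<mu>: "circle_prob \<mu>"
  shows "(\<integral>z. z ^ j * cnj z ^ l \<partial>\<mu>) = (if l \<le> j then fourier \<mu> (j - l) else cnj (fourier \<mu> (l - j)))"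
proof -
  have *: "z ^ j * cnj z ^ l = (if l \<le> j then z ^ (j - l) else cnj (z ^ (l - j)))" if "z \<in> space \<mu>" for z
  proof -
    have "z * cnj z = 1"
      using that by (auto simp: space_circle_prob[OF \<mu>] complex_norm_square[symmetric])
    then have u: "z ^ n * cnj z ^ n = 1" for n
      by (simp flip: power_mult_distrib)
    show ?thesis
    proof (cases "l \<le> j")
      case True
      then have "z ^ j = z ^ (j - l) * z ^ l"
        by (simp flip: power_add)
      then show ?thesis
        using True u[of l] by (simp add: mult.assoc)
    next
      case False
      then have "cnj z ^ l = cnj z ^ j * cnj z ^ (l - j)"
        by (simp flip: power_add)
      then show ?thesis
        using False u[of j] by (simp add: mult.assoc[symmetric])
    qed
  qed
  then have "(\<integral>z. z ^ j * cnj z ^ l \<partial>\<mu>) = (\<integral>z. (if l \<le> j then z ^ (j - l) else cnj (z ^ (l - j))) \<partial>\<mu>)"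
    by (intro Bochner_Integration.integral_cong) auto
  also have "\<dots> = (if l \<le> j then fourier \<mu> (j - l) else cnj (fourier \<mu> (l - j)))"
    by (simp add: fourier_def del: complex_cnj_power)
  finally show ?thesis .
qed

text \<open>Rewrites a real coordinate functional in terms of z and \<open>cnj z\<close>, so that
  real polynomials on the plane become polynomials in these two.\<close>

lemma bounded_linear_complex_real:
  fixes f :: "complex \<Rightarrow> real"
  assumes "bounded_linear f"
  shows "of_real (f z) = Complex (f 1 / 2) (- f \<i> / 2) * z + Complex (f 1 / 2) (f \<i> / 2) * cnj z"
proof -
  interpret bounded_linear f by fact
  have "z = Re z *\<^sub>R 1 + Im z *\<^sub>R \<i>"
    by (simp add: complex_eq_iff)
  then have "f z = Re z * f 1 + Im z * f \<i>"
    by (metis add scaleR real_scaleR_def)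
  then show ?thesis
    by (simp add: complex_eq_iff algebra_simps)
qed

lemma integral_eq_of_fourier_eq:
  fixes f :: "complex \<Rightarrow> real"
  assumes \<mu>: "circle_prob \<mu>" and \<nu>: "circle_prob \<nu>"
    and eq: "\<And>k. fourier \<mu> k = fourier \<nu> k" and f: "continuous_on circle f"
  shows "(\<integral>z. f z \<partial>\<mu>) = (\<integral>z. f z \<partial>\<nu>)"
proof -
  interpret \<mu>: prob_space \<mu> by (rule circle_prob_space[OF \<mu>])
  interpret \<nu>: prob_space \<nu> by (rule circle_prob_space[OF \<nu>])
  \<comment> \<open>Testing against all mixed monomials, and not only integrating g, makes the class
    stable under multiplication by z and \<open>cnj z\<close>.\<close>
  define G where "G = {g :: complex \<Rightarrow> complex. continuous_on circle g \<and>
    (\<forall>j l. (\<integral>z. g z * (z ^ j * cnj z ^ l) \<partial>\<mu>) = (\<integral>z. g z * (z ^ j * cnj z ^ l) \<partial>\<nu>))}"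
  note int = circle_prob_integrable[OF \<mu>] circle_prob_integrable[OF \<nu>]
  have G_add: "(\<lambda>z. a * g z + b * h z) \<in> G" if "g \<in> G" "h \<in> G" for g h a b
  proof -
    have c: "continuous_on circle g" "continuous_on circle h"
      using that by (auto simp: G_def)
    have "integrable M (\<lambda>z. a * (g z * (z ^ j * cnj z ^ l)))" "integrable M (\<lambda>z. b * (h z * (z ^ j * cnj z ^ l)))"
      if "M \<in> {\<mu>, \<nu>}" for j l M
      using that by (auto intro!: int continuous_intros c)
    then show ?thesis
      using that c by (auto simp: G_def distrib_right mult.assoc intro!: continuous_intros)
  qed
  have G_z: "(\<lambda>z. z * g z) \<in> G" "(\<lambda>z. cnj z * g z) \<in> G" if "g \<in> G" for g
  proof -
    have 1: "z * g z * (z ^ j * cnj z ^ l) = g z * (z ^ Suc j * cnj z ^ l)" for z j l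
      by simp
    have 2: "cnj z * g z * (z ^ j * cnj z ^ l) = g z * (z ^ j * cnj z ^ Suc l)" for z j l
      by simp
    show "(\<lambda>z. z * g z) \<in> G"
      using that unfolding G_def mem_Collect_eq 1 by (auto intro!: continuous_intros simp del: power_Suc)
    show "(\<lambda>z. cnj z * g z) \<in> G"
      using that unfolding G_def mem_Collect_eq 2 by (auto intro!: continuous_intros simp del: power_Suc)
  qed
  \<comment> \<open>The claim is that p acts on the class as a multiplier; with g arbitrary, the
    case of a product of polynomials is a composition of two multipliers.\<close>
  have poly: "(\<lambda>z. of_real (p z) * g z) \<in> G" if "real_polynomial_function p" "g \<in> G" for p g
    using that
  proof (induction arbitrary: g)
    case (linear p)
    show ?case
      using G_add[OF G_z[OF linear(2)], of "Complex (p 1 / 2) (- p \<i> / 2)" "Complex (p 1 / 2) (p \<i> / 2)"]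
      by (simp add: bounded_linear_complex_real[OF linear(1)] distrib_right mult.assoc)
  next
    case (const c)
    show ?case
      using G_add[OF const const, of "of_real c" 0] by simp
  next
    case (add p q)
    show ?case
      using G_add[OF add(3)[OF add(5)] add(4)[OF add(5)], of 1 1] by (simp add: distrib_right)
  next
    case (mult p q)
    show ?case
      using mult(3)[OF mult(4)[OF mult(5)]] by (simp add: mult.assoc)
  qed
  have one: "(\<lambda>_. 1) \<in> G"
    by (auto simp: G_def moment_circle_prob[OF \<mu>] moment_circle_prob[OF \<nu>] eq)
  have p_eq: "(\<integral>z. p z \<partial>\<mu>) = (\<integral>z. p z \<partial>\<nu>)" if "real_polynomial_function p" for p
  proof -
    have "\<forall>j l. (\<integral>z. of_real (p z) * 1 * (z ^ j * cnj z ^ l) \<partial>\<mu>) = (\<integral>z. of_real (p z) * 1 * (z ^ j * cnj z ^ l) \<partial>\<nu>)"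
      using poly[OF that one] unfolding G_def by blast
    from this[rule_format, of 0 0] show ?thesis
      by simp
  qed
  have "\<bar>(\<integral>z. f z \<partial>\<mu>) - (\<integral>z. f z \<partial>\<nu>)\<bar> \<le> e" if e: "e > 0" for e
  proof -
    obtain p where p: "real_polynomial_function p" and close: "\<And>z. z \<in> circle \<Longrightarrow> \<bar>f z - p z\<bar> < e / 2"
      using Stone_Weierstrass_real_polynomial_function[OF _ f, of "e / 2"] e by auto
    have pc: "continuous_on circle p"
      using p continuous_on_polymonial_function real_polynomial_function_eq by blast
    have "\<bar>(\<integral>z. f z \<partial>M) - (\<integral>z. p z \<partial>M)\<bar> \<le> e / 2" if M: "circle_prob M" for M
    proof -
      interpret prob_space M by (rule circle_prob_space[OF M])
      have i: "integrable M f" "integrable M p"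
        by (auto intro!: circle_prob_integrable[OF M] f pc)
      have "\<bar>\<integral>z. f z - p z \<partial>M\<bar> \<le> (\<integral>z. \<bar>f z - p z\<bar> \<partial>M)"
        by (rule integral_abs_bound)
      also have "\<dots> \<le> e / 2"
        using close i by (intro integral_le_const AE_I2) (auto simp: space_circle_prob[OF M] less_imp_le)
      finally show ?thesis
        using i by simp
    qed
    from this[OF \<mu>] this[OF \<nu>] p_eq[OF p] show ?thesis
      by linarith
  qed
  then show ?thesis
    using field_le_epsilon[of "\<bar>(\<integral>z. f z \<partial>\<mu>) - (\<integral>z. f z \<partial>\<nu>)\<bar>" 0] by simp
qed

text \<open>Equal integrals of continuous functions give equal masses of closed sets, which form an
  intersection-stable generator of the Borel sets. The comparison takes place on the whole plane,
  after pushing both measures forward along the inclusion.\<close>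

lemma circle_prob_eqI_fourier:
  assumes \<mu>: "circle_prob \<mu>" and \<nu>: "circle_prob \<nu>"
    and eq: "\<And>k. fourier \<mu> k = fourier \<nu> k"
  shows "\<mu> = \<nu>"
proof -
  have closed_eq: "emeasure \<mu> (A \<inter> circle) = emeasure \<nu> (A \<inter> circle)" if A: "closed A" for A
  proof (cases "A = {}")
    case False
    \<comment> \<open>Continuous cutoffs that decrease to the indicator of the closed set A.\<close>
    define f where "f n z = max 0 (1 - real n * infdist z A)" for n and z :: complex
    have cont: "continuous_on S (f n)" for n S
      unfolding f_def by (intro continuous_intros)
    have f01: "0 \<le> f n z" "f n z \<le> 1" for n z
      by (auto simp: f_def infdist_nonneg)
    have lim: "(\<lambda>n. f n z) \<longlonglongrightarrow> indicator A z" for z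
    proof (cases "z \<in> A")
      case True
      then show ?thesis
        by (simp add: f_def)
    next
      case z: False
      then have d: "0 < infdist z A"
        using A False infdist_pos_not_in_closed by blast
      obtain N where N: "1 / infdist z A < real N"
        using reals_Archimedean2 by blast
      have "f n z = 0" if "n \<ge> N" for n
      proof -
        have "1 / infdist z A < real n"
          using N that by simp
        then show ?thesis
          using d by (simp add: f_def field_simps)
      qed
      then have "\<forall>\<^sub>F n in sequentially. f n z = 0"
        by (auto simp: eventually_sequentially)
      then show ?thesis
        using z by (simp add: tendsto_eventually)
    qed
    have "(\<lambda>n. \<integral>z. f n z \<partial>M) \<longlonglongrightarrow> measure M (A \<inter> circle)" if M: "circle_prob M" for M
    proof -
      interpret prob_space M by (rule circle_prob_space[OF M])
      have "A \<inter> circle \<in> sets M"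
        using A by (auto simp: sets_circle_prob[OF M] sets_restrict_space)
      have "(\<lambda>n. \<integral>z. f n z \<partial>M) \<longlonglongrightarrow> (\<integral>z. indicator A z \<partial>M)"
        by (rule integral_dominated_convergence[where w="\<lambda>_. 1"])
          (use lim f01 A in \<open>auto intro!: circle_prob_measurable[OF M] cont
             measurable_compose[OF circle_prob_ident_measurable[OF M] borel_measurable_indicator]\<close>)
      also have "(\<integral>z. indicator A z \<partial>M) = (\<integral>z. indicator (A \<inter> circle) z \<partial>M)"
        by (intro Bochner_Integration.integral_cong) (auto simp: space_circle_prob[OF M] indicator_def)
      also have "\<dots> = measure M (A \<inter> circle)"
        by (simp add: space_circle_prob[OF M] Int_assoc)
      finally show ?thesis .
    qed
    from this[OF \<mu>] this[OF \<nu>] have "measure \<mu> (A \<inter> circle) = measure \<nu> (A \<inter> circle)"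
      unfolding integral_eq_of_fourier_eq[OF \<mu> \<nu> eq cont] by (rule LIMSEQ_unique)
    then show ?thesis
      using circle_prob_space[OF \<mu>] circle_prob_space[OF \<nu>]
      by (simp add: finite_measure.emeasure_eq_measure prob_space.finite_measure)
  qed simp
  have emb: "emeasure (distr M borel (\<lambda>z. z)) A = emeasure M (A \<inter> circle)"
    if "circle_prob M" "A \<in> sets borel" for A M
    using that by (simp add: emeasure_distr circle_prob_ident_measurable space_circle_prob)
  have "distr \<mu> borel (\<lambda>z. z) = distr \<nu> borel (\<lambda>z. z)"
  proof (rule measure_eqI_generator_eq[where \<Omega>=UNIV and E="Collect closed" and A="\<lambda>_. UNIV"])
    show "emeasure (distr \<mu> borel (\<lambda>z. z)) X = emeasure (distr \<nu> borel (\<lambda>z. z)) X" if "X \<in> Collect closed" for X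
      using that by (simp add: emb \<mu> \<nu> closed_eq)
    show "emeasure (distr \<mu> borel (\<lambda>z. z)) UNIV \<noteq> \<infinity>"
      using prob_space.emeasure_space_1[OF circle_prob_space[OF \<mu>]]
      by (simp add: emb \<mu> space_circle_prob[OF \<mu>])
  qed (auto simp: Int_stable_def borel_eq_closed)
  note borel_eq = this
  show ?thesis
  proof (rule measure_eqI)
    show "sets \<mu> = sets \<nu>"
      by (simp add: sets_circle_prob \<mu> \<nu>)
    fix A assume "A \<in> sets \<mu>"
    then obtain B where "B \<in> sets borel" "A = B \<inter> circle"
      by (auto simp: sets_circle_prob[OF \<mu>] sets_restrict_space)
    then show "emeasure \<mu> A = emeasure \<nu> A"
      using emb[OF \<mu>] emb[OF \<nu>] borel_eq by metis
  qed
qed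

section \<open>Convexity of the energy and the direct method\<close>

lemma energy_coeff_midpoint:
  assumes "fourier \<eta> k = (fourier \<mu> k + fourier \<nu> k) / 2"
  shows "energy_coeff \<eta> k = (energy_coeff \<mu> k + energy_coeff \<nu> k) / 2 - (cmod (fourier \<mu> k - fourier \<nu> k))\<^sup>2 / (4 * real k)"
proof -
  have "(cmod (fourier \<eta> k))\<^sup>2 = ((cmod (fourier \<mu> k))\<^sup>2 + (cmod (fourier \<nu> k))\<^sup>2) / 2 - (cmod (fourier \<mu> k - fourier \<nu> k))\<^sup>2 / 4"
    unfolding assms cmod_power2 by (simp add: power2_eq_square field_simps)
  then show ?thesis
    by (simp add: energy_coeff_def add_divide_distrib diff_divide_distrib)
qed

text \<open>By the parallelogram law, averaging two minimisers lowers the energy by a weighted sum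
  of squared differences of their Fourier coefficients. One differing coefficient suffices for a
  contradiction.\<close>

lemma energy_minimizer_unique:
  assumes Q: "continuous_on circle Q"
    and \<mu>: "circle_prob \<mu>" "energy Q \<mu> \<le> ereal e" and \<nu>: "circle_prob \<nu>" "energy Q \<nu> \<le> ereal e"
    and min: "\<And>\<eta> c. circle_prob \<eta> \<Longrightarrow> energy Q \<eta> \<le> ereal c \<Longrightarrow> e \<le> c"
  shows "\<mu> = \<nu>"
proof (rule ccontr)
  assume "\<mu> \<noteq> \<nu>"
  then obtain k where k: "fourier \<mu> k \<noteq> fourier \<nu> k"
    using circle_prob_eqI_fourier[OF \<mu>(1) \<nu>(1)] by auto
  have "fourier M 0 = 1" if "circle_prob M" for M
    using prob_space.prob_space[OF circle_prob_space[OF that]] by (simp add: fourier_def)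
  then have "k \<noteq> 0"
    using k \<mu> \<nu> by metis
  \<comment> \<open>The gain from the single index k. It is positive because k is not 0: all
    probability measures share the zeroth coefficient.\<close>
  define \<delta> where "\<delta> = (cmod (fourier \<mu> k - fourier \<nu> k))\<^sup>2 / (4 * real k)"
  have "\<delta> > 0"
    using k \<open>k \<noteq> 0\<close> by (simp add: \<delta>_def)
  obtain \<eta> where \<eta>: "circle_prob \<eta>"
    and mid: "\<And>f :: complex \<Rightarrow> complex. continuous_on circle f \<Longrightarrow>
      (\<integral>z. f z \<partial>\<eta>) = ((\<integral>z. f z \<partial>\<mu>) + (\<integral>z. f z \<partial>\<nu>)) / 2"
    using circle_prob_midpoint[OF \<mu>(1) \<nu>(1)] by metis
  have "complex_of_real (\<integral>z. Q z \<partial>\<eta>) = of_real (((\<integral>z. Q z \<partial>\<mu>) + (\<integral>z. Q z \<partial>\<nu>)) / 2)"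
    using mid[of "\<lambda>z. of_real (Q z)"] Q by (simp add: continuous_on_of_real)
  then have Qmid: "(\<integral>z. Q z \<partial>\<eta>) = ((\<integral>z. Q z \<partial>\<mu>) + (\<integral>z. Q z \<partial>\<nu>)) / 2"
    by (simp only: of_real_eq_iff)
  have fmid: "fourier \<eta> j = (fourier \<mu> j + fourier \<nu> j) / 2" for j
    unfolding fourier_def by (intro mid continuous_intros)
  note coeff = energy_coeff_midpoint[OF fmid]
  have "(\<integral>z. Q z \<partial>\<eta>) + (\<Sum>j<n. energy_coeff \<eta> j) \<le> e - \<delta>" for n
  proof -
    \<comment> \<open>A partial sum with at most k terms would miss the gain at k; it is bounded by
      a longer one that includes it.\<close>
    let ?m = "max n (Suc k)"
    have "\<delta> \<le> (\<Sum>j<?m. (cmod (fourier \<mu> j - fourier \<nu> j))\<^sup>2 / (4 * real j))"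
      unfolding \<delta>_def by (rule member_le_sum) auto
    moreover have "(\<integral>z. Q z \<partial>\<mu>) + (\<Sum>j<?m. energy_coeff \<mu> j) \<le> e" "(\<integral>z. Q z \<partial>\<nu>) + (\<Sum>j<?m. energy_coeff \<nu> j) \<le> e"
      using \<mu> \<nu> by (auto simp: energy_le_iff)
    moreover have "(\<Sum>j<n. energy_coeff \<eta> j) \<le> (\<Sum>j<?m. energy_coeff \<eta> j)"
      by (intro sum_mono2) (auto simp: energy_coeff_nonneg)
    moreover have "(\<Sum>j<?m. energy_coeff \<eta> j) = ((\<Sum>j<?m. energy_coeff \<mu> j) + (\<Sum>j<?m. energy_coeff \<nu> j)) / 2
        - (\<Sum>j<?m. (cmod (fourier \<mu> j - fourier \<nu> j))\<^sup>2 / (4 * real j))"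
      by (simp only: coeff sum_subtractf sum.distrib flip: sum_divide_distrib)
    ultimately show ?thesis
      unfolding Qmid by (simp add: field_simps)
  qed
  then have "energy Q \<eta> \<le> ereal (e - \<delta>)"
    by (simp add: energy_le_iff[OF \<eta>])
  from min[OF \<eta> this] \<open>\<delta> > 0\<close> show False
    by simp
qed

text \<open>The minimum is described through real upper bounds of energies, so that it is an infimum
  of a set of reals and feeds directly into \<open>energy_le_iff\<close>.\<close>

lemma energy_minimizer_exists:
  assumes Q: "continuous_on circle Q"
  obtains \<nu> e where "circle_prob \<nu>" "energy Q \<nu> \<le> ereal e"
    "\<And>\<eta> c. circle_prob \<eta> \<Longrightarrow> energy Q \<eta> \<le> ereal c \<Longrightarrow> e \<le> c"
proof -
  define S where "S = {c. \<exists>\<mu>. circle_prob \<mu> \<and> energy Q \<mu> \<le> ereal c}"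
  have "compact (Q ` circle)"
    by (intro compact_continuous_image Q) auto
  then obtain B where B: "\<And>z. z \<in> circle \<Longrightarrow> \<bar>Q z\<bar> \<le> B"
    using compact_imp_bounded bounded_iff by (metis imageI real_norm_def)
  have low: "- B \<le> c" if c: "c \<in> S" for c
  proof -
    obtain \<mu> where \<mu>: "circle_prob \<mu>" "energy Q \<mu> \<le> ereal c"
      using c by (auto simp: S_def)
    interpret prob_space \<mu> by (rule circle_prob_space[OF \<mu>(1)])
    have "(\<integral>z. Q z \<partial>\<mu>) \<le> c"
      using \<mu>(2) energy_le_iff[OF \<mu>(1)] by (auto dest: spec[of _ 0])
    moreover have "- B \<le> (\<integral>z. Q z \<partial>\<mu>)"
    proof (intro integral_ge_const circle_prob_integrable[OF \<mu>(1)] Q AE_I2)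
      show "- B \<le> Q z" if "z \<in> space \<mu>" for z
        using B[of z] that by (auto simp: space_circle_prob[OF \<mu>(1)])
    qed
    ultimately show ?thesis
      by simp
  qed
  have "S \<noteq> {}"
    using energy_haar_le circle_prob_haar by (auto simp: S_def)
  have bdd: "bdd_below S"
    using low by (auto simp: bdd_below_def)
  have "\<exists>\<mu>. circle_prob \<mu> \<and> energy Q \<mu> \<le> ereal (Inf S + 1 / real (Suc n))" for n
  proof -
    obtain c where "c \<in> S" "c < Inf S + 1 / real (Suc n)"
      using cInf_lessD[OF \<open>S \<noteq> {}\<close>, of "Inf S + 1 / real (Suc n)"] by auto
    then obtain \<mu> where "circle_prob \<mu>" "energy Q \<mu> \<le> ereal c"
      unfolding S_def by blast
    moreover have "ereal c \<le> ereal (Inf S + 1 / real (Suc n))"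
      using \<open>c < _\<close> by simp
    ultimately show ?thesis
      using order_trans by blast
  qed
  then obtain \<mu> where \<mu>: "\<And>n. circle_prob (\<mu> n)" "\<And>n. energy Q (\<mu> n) \<le> ereal (Inf S + 1 / real (Suc n))"
    by metis
  obtain r \<nu> where r: "strict_mono r" and \<nu>: "circle_prob \<nu>"
    and conv: "\<And>f :: complex \<Rightarrow> complex. continuous_on circle f \<Longrightarrow>
      (\<lambda>n. \<integral>z. f z \<partial>\<mu> (r n)) \<longlonglongrightarrow> (\<integral>z. f z \<partial>\<nu>)"
    using circle_prob_seq_compact[of \<mu>] \<mu>(1) by metis
  have "(\<lambda>n. complex_of_real (\<integral>z. Q z \<partial>\<mu> (r n))) \<longlonglongrightarrow> of_real (\<integral>z. Q z \<partial>\<nu>)"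
    using conv[of "\<lambda>z. of_real (Q z)"] Q by (simp add: continuous_on_of_real)
  then have Qlim: "(\<lambda>n. \<integral>z. Q z \<partial>\<mu> (r n)) \<longlonglongrightarrow> (\<integral>z. Q z \<partial>\<nu>)"
    by (simp only: tendsto_of_real_iff)
  have flim: "(\<lambda>n. fourier (\<mu> (r n)) k) \<longlonglongrightarrow> fourier \<nu> k" for k
    unfolding fourier_def by (intro conv continuous_intros)
  \<comment> \<open>Lower semicontinuity: for fixed m the truncated energy converges along the
    subsequence, and each truncation is at most the full energy.\<close>
  have "(\<integral>z. Q z \<partial>\<nu>) + (\<Sum>k<m. energy_coeff \<nu> k) \<le> Inf S" for m
  proof (rule LIMSEQ_le)
    show "(\<lambda>n. (\<integral>z. Q z \<partial>\<mu> (r n)) + (\<Sum>k<m. energy_coeff (\<mu> (r n)) k)) \<longlonglongrightarrow> (\<integral>z. Q z \<partial>\<nu>) + (\<Sum>k<m. energy_coeff \<nu> k)"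
      unfolding energy_coeff_def divide_inverse by (intro tendsto_intros Qlim flim)
    have "(\<lambda>n. Inf S + 1 / real (Suc n)) \<longlonglongrightarrow> Inf S + 0"
      using LIMSEQ_inverse_real_of_nat by (intro tendsto_intros) (simp add: inverse_eq_divide)
    then show "(\<lambda>n. Inf S + 1 / real (Suc (r n))) \<longlonglongrightarrow> Inf S"
      using LIMSEQ_subseq_LIMSEQ[OF _ r] by (fastforce simp: o_def)
    show "\<exists>N. \<forall>n\<ge>N. (\<integral>z. Q z \<partial>\<mu> (r n)) + (\<Sum>k<m. energy_coeff (\<mu> (r n)) k) \<le> Inf S + 1 / real (Suc (r n))"
      using \<mu> by (simp add: energy_le_iff)
  qed
  then have "energy Q \<nu> \<le> ereal (Inf S)"
    by (simp add: energy_le_iff[OF \<nu>])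
  moreover have "Inf S \<le> c" if "circle_prob \<eta>" "energy Q \<eta> \<le> ereal c" for \<eta> c
    using that bdd by (intro cInf_lower) (auto simp: S_def)
  ultimately show thesis
    using \<nu> that by blast
qed

lemma circle_prob_equilibrium:
  assumes Q: "continuous_on circle Q"
  shows "circle_prob (equilibrium Q)"
proof -
  obtain \<nu> e where \<nu>: "circle_prob \<nu>" "energy Q \<nu> \<le> ereal e"
    and min: "\<And>\<eta> c. circle_prob \<eta> \<Longrightarrow> energy Q \<eta> \<le> ereal c \<Longrightarrow> e \<le> c"
    using energy_minimizer_exists[OF Q] by metis
  have "energy Q \<nu> \<le> energy Q \<mu>" if "circle_prob \<mu>" for \<mu>
  proof -
    \<comment> \<open>The lower bound is known only against real upper bounds of the energy, so a
      real number is inserted between the two sides.\<close>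
    have "ereal e \<le> energy Q \<mu>"
    proof (rule ccontr)
      assume "\<not> ereal e \<le> energy Q \<mu>"
      then obtain c where "energy Q \<mu> < ereal c" "ereal c < ereal e"
        using ereal_dense2[of "energy Q \<mu>" "ereal e"] by (auto simp: not_le)
      with min[OF that, of c] show False
        by (simp add: less_imp_le)
    qed
    with \<nu>(2) show ?thesis
      by (rule order_trans)
  qed
  then have "equilibrium Q = \<nu>"
    unfolding equilibrium_def using \<nu>
    by (intro the_equality) (auto intro!: energy_minimizer_unique[OF Q _ _ \<nu> min] intro: order_trans)
  with \<nu> show ?thesis
    by simp
qed

section \<open>Finiteness of the modified Wasserstein distance\<close>

text \<open>For u between 0 and \<open>2 * pi\<close> this is the argument of z in the window from u
  to \<open>u + 2 * pi\<close>.\<close>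

definition arg_from :: "real \<Rightarrow> complex \<Rightarrow> real" where
  "arg_from u z = (if u \<le> Arg2pi z then Arg2pi z else Arg2pi z + 2 * pi)"

lemma infsum_ennreal_eq_nn_integral:
  fixes f :: "int \<Rightarrow> ennreal"
  shows "(\<Sum>\<^sub>\<infinity>n\<in>UNIV. f n) = (\<integral>\<^sup>+n. f n \<partial>count_space UNIV)"
proof -
  have bij: "bij_betw int_decode UNIV (UNIV :: int set)"
    by (rule bij_int_decode)
  have "(\<Sum>\<^sub>\<infinity>n\<in>UNIV. f n) = (\<Sum>\<^sub>\<infinity>n\<in>UNIV. f (int_decode n))"
    by (rule infsum_reindex_bij_betw[OF bij, symmetric])
  also have "\<dots> = (\<Sum>n. f (int_decode n))"
    by (intro sums_unique has_sum_imp_sums has_sum_infsum nonneg_summable_on_complete) simp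
  also have "\<dots> = (\<integral>\<^sup>+n. f n \<partial>count_space UNIV)"
    by (simp add: nn_integral_bij_count_space[OF bij, symmetric] nn_integral_count_space_nat)
  finally show ?thesis .
qed

lemma Arg2pi_measurable_circle_prob:
  assumes "circle_prob \<mu>"
  shows "Arg2pi \<in> borel_measurable \<mu>"
  by (rule measurable_compose[OF circle_prob_ident_measurable[OF assms] borel_measurable_Arg2pi])

text \<open>Turns an image under \<open>cis\<close> into a preimage under a shifted argument, from
  which measurability can be read off.\<close>

lemma cis_image_period:
  "cis ` (A \<inter> {2 * of_int n * pi..<2 * (of_int n + 1) * pi}) = {z \<in> circle. Arg2pi z + 2 * of_int n * pi \<in> A}"
proof -
  have cis_shift: "cis (x + 2 * of_int n * pi) = cis x" for x
  proof -
    have "cis (2 * of_int n * pi) = 1"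
      using cis_multiple_2pi[of "of_int n"] by (simp add: mult_ac)
    then show ?thesis
      by (simp flip: cis_mult)
  qed
  show ?thesis
  proof (intro set_eqI iffI)
    fix z assume "z \<in> cis ` (A \<inter> {2 * of_int n * pi..<2 * (of_int n + 1) * pi})"
    then obtain x where x: "x \<in> A" "2 * of_int n * pi \<le> x" "x < 2 * (of_int n + 1) * pi" "z = cis x"
      by auto
    have "Arg2pi (cis (x - 2 * of_int n * pi)) = x - 2 * of_int n * pi"
      using x by (intro Arg2pi_cis) (auto simp: algebra_simps)
    moreover have "cis (x - 2 * of_int n * pi) = z"
      using cis_shift[of "x - 2 * of_int n * pi"] x by simp
    ultimately show "z \<in> {z \<in> circle. Arg2pi z + 2 * of_int n * pi \<in> A}"
      using x by auto
  next
    fix z assume z: "z \<in> {z \<in> circle. Arg2pi z + 2 * of_int n * pi \<in> A}"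
    then have "z = cis (Arg2pi z + 2 * of_int n * pi)"
      by (simp add: cis_shift cis_Arg2pi)
    moreover have "Arg2pi z + 2 * of_int n * pi \<in> {2 * of_int n * pi..<2 * (of_int n + 1) * pi}"
      using Arg2pi[of z] by (auto simp: algebra_simps)
    ultimately show "z \<in> cis ` (A \<inter> {2 * of_int n * pi..<2 * (of_int n + 1) * pi})"
      using z by blast
  qed
qed

text \<open>The measure \<open>measure_of\<close> takes the values of the given set function only
  once countable additivity is known. The n-th summand is the law of \<open>Arg2pi\<close> shifted
  by \<open>2 * n * pi\<close>, so additivity is an exchange of a series with an integral over the
  counting measure on the integers.\<close>

lemma emeasure_circle_lift:
  assumes \<mu>: "circle_prob \<mu>" and A: "A \<in> sets borel"
  shows "emeasure (circle_lift \<mu>) A = (\<Sum>\<^sub>\<infinity>n\<in>UNIV. emeasure \<mu> {z \<in> circle. Arg2pi z + 2 * of_int n * pi \<in> A})"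
proof -
  define D where "D n = distr \<mu> borel (\<lambda>z. Arg2pi z + 2 * of_int n * pi)" for n :: int
  note [measurable] = Arg2pi_measurable_circle_prob[OF \<mu>]
  have D: "emeasure \<mu> {z \<in> circle. Arg2pi z + 2 * of_int n * pi \<in> B} = emeasure (D n) B" if "B \<in> sets borel" for n B
    unfolding D_def using that
    by (subst emeasure_distr) (auto simp: space_circle_prob[OF \<mu>] vimage_def Int_def intro!: arg_cong[where f="emeasure \<mu>"])
  have sets: "sets (circle_lift \<mu>) = sets borel"
    unfolding circle_lift_def using sets.sets_measure_of_eq[of "borel :: real measure"] by simp
  let ?f = "\<lambda>A. \<Sum>\<^sub>\<infinity>n\<in>(UNIV :: int set). emeasure \<mu> {z \<in> circle. Arg2pi z + 2 * of_int n * pi \<in> A}"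
  have f: "?f B = (\<integral>\<^sup>+n. emeasure (D n) B \<partial>count_space UNIV)" if "B \<in> sets borel" for B
    unfolding infsum_ennreal_eq_nn_integral D[OF that] ..
  show ?thesis
  proof (rule emeasure_measure_of[OF circle_lift_def[unfolded cis_image_period]])
    show "positive (sets (circle_lift \<mu>)) ?f"
      by (simp add: positive_def)
    show "countably_additive (sets (circle_lift \<mu>)) ?f"
    proof (rule countably_additiveI)
      fix B :: "nat \<Rightarrow> real set"
      assume B: "range B \<subseteq> sets (circle_lift \<mu>)" "disjoint_family B"
      have "(\<Sum>i. ?f (B i)) = (\<Sum>i. \<integral>\<^sup>+n. emeasure (D n) (B i) \<partial>count_space UNIV)"
        using B by (intro suminf_cong f) (auto simp: sets)
      also have "\<dots> = (\<integral>\<^sup>+n. (\<Sum>i. emeasure (D n) (B i)) \<partial>count_space UNIV)"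
        by (rule nn_integral_suminf[symmetric]) simp
      also have "\<dots> = (\<integral>\<^sup>+n. emeasure (D n) (\<Union>i. B i) \<partial>count_space UNIV)"
        using B by (intro nn_integral_cong suminf_emeasure) (auto simp: sets D_def)
      also have "\<dots> = ?f (\<Union>i. B i)"
        using B by (intro f[symmetric]) (auto simp: sets)
      finally show "(\<Sum>i. ?f (B i)) = ?f (\<Union>i. B i)" .
    qed
  qed (use A sets in \<open>auto simp: sets_eq_imp_space_eq\<close>)
qed

lemma arg_from_measurable:
  assumes "circle_prob \<mu>"
  shows "arg_from u \<in> borel_measurable \<mu>"
proof -
  note [measurable] = Arg2pi_measurable_circle_prob[OF assms]
  show ?thesis
    unfolding arg_from_def by measurable
qed

text \<open>A window starting between 0 and \<open>2 * pi\<close> meets only the copies n = 0 and n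
  = 1 of the circle, and the two pieces together contain each angle once.\<close>

lemma circle_window_eq_distr:
  assumes \<mu>: "circle_prob \<mu>" and u: "0 \<le> u" "u \<le> 2 * pi"
  shows "circle_window \<mu> u = distr \<mu> borel (arg_from u)"
proof (rule measure_eqI)
  note [measurable] = Arg2pi_measurable_circle_prob[OF \<mu>]
  have sets [measurable_cong, simp]: "sets (circle_lift \<mu>) = sets borel"
    unfolding circle_lift_def using sets.sets_measure_of_eq[of "borel :: real measure"] by simp
  show "sets (circle_window \<mu> u) = sets (distr \<mu> borel (arg_from u))"
    by (simp add: circle_window_def)
  fix A assume "A \<in> sets (circle_window \<mu> u)"
  then have A [measurable]: "A \<in> sets borel"
    by (simp add: circle_window_def)
  let ?B = "A \<inter> {u..<u + 2 * pi}"
  define E where "E n = {z \<in> circle. Arg2pi z + 2 * of_int n * pi \<in> ?B}" for n :: int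
  have E_sets: "E n \<in> sets \<mu>" for n
  proof -
    have "E n = {z \<in> space \<mu>. Arg2pi z + 2 * of_int n * pi \<in> ?B}"
      by (simp add: E_def space_circle_prob[OF \<mu>])
    also have "\<dots> \<in> sets \<mu>"
      by measurable
    finally show ?thesis .
  qed
  \<comment> \<open>Copies with n \<le> -1 end before 0 and those with n \<ge> 2 start at
    \<open>4 * pi\<close>, beyond the window.\<close>
  have E0: "E n = {}" if n: "n \<noteq> 0" "n \<noteq> 1" for n
  proof -
    have "Arg2pi z + 2 * of_int n * pi \<notin> {u..<u + 2 * pi}" for z
    proof -
      consider "n \<le> -1" | "n \<ge> 2"
        using n by linarith
      then show ?thesis
      proof cases
        case 1
        then have "of_int n * pi \<le> -1 * pi"
          by (intro mult_right_mono) (auto simp: of_int_le_iff[of n "-1", where 'a=real, simplified])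
        then show ?thesis
          using Arg2pi[of z] u by auto
      next
        case 2
        then have "2 * pi \<le> of_int n * pi"
          by (intro mult_right_mono) auto
        then have "u + 2 * pi \<le> Arg2pi z + 2 * of_int n * pi"
          using Arg2pi[of z] u by linarith
        then show ?thesis
          by simp
      qed
    qed
    then show ?thesis
      by (auto simp: E_def)
  qed
  have "emeasure (circle_window \<mu> u) A = (\<integral>\<^sup>+x. indicator {u..<u + 2 * pi} x * indicator A x \<partial>circle_lift \<mu>)"
    unfolding circle_window_def by (rule emeasure_density) auto
  also have "\<dots> = (\<integral>\<^sup>+x. indicator ?B x \<partial>circle_lift \<mu>)"
    by (intro nn_integral_cong) (auto simp: indicator_def)
  also have "\<dots> = emeasure (circle_lift \<mu>) ?B"
    by (intro nn_integral_indicator) simp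
  also have "\<dots> = (\<Sum>\<^sub>\<infinity>n\<in>UNIV. emeasure \<mu> (E n))"
    unfolding E_def by (intro emeasure_circle_lift[OF \<mu>]) simp
  also have "\<dots> = (\<Sum>\<^sub>\<infinity>n\<in>{0, 1}. emeasure \<mu> (E n))"
    by (rule infsum_cong_neutral) (auto simp: E0)
  also have "\<dots> = emeasure \<mu> (E 0) + emeasure \<mu> (E 1)"
    by simp
  also have "\<dots> = emeasure \<mu> (E 0 \<union> E 1)"
    using Arg2pi u by (intro plus_emeasure E_sets) (auto simp: E_def)
  also have "E 0 \<union> E 1 = arg_from u -` A \<inter> space \<mu>"
    using Arg2pi u unfolding E_def arg_from_def space_circle_prob[OF \<mu>]
    by (auto simp: not_le split: if_splits intro: order_trans less_le_trans add_increasing)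
  also have "emeasure \<mu> \<dots> = emeasure (distr \<mu> borel (arg_from u)) A"
    by (rule emeasure_distr[symmetric]) (auto intro: arg_from_measurable[OF \<mu>])
  finally show "emeasure (circle_window \<mu> u) A = emeasure (distr \<mu> borel (arg_from u)) A" .
qed

section \<open>Windows with equal means\<close>

lemma circle_window_mean:
  assumes \<mu>: "circle_prob \<mu>" and u: "0 \<le> u" "u \<le> 2 * pi"
  shows "(\<integral>x. x \<partial>circle_window \<mu> u) = (\<integral>z. Arg2pi z \<partial>\<mu>) + 2 * pi * measure \<mu> {z \<in> space \<mu>. Arg2pi z < u}"
proof -
  note [measurable] = Arg2pi_measurable_circle_prob[OF \<mu>]
  interpret prob_space \<mu> by (rule circle_prob_space[OF \<mu>])
  have S: "{z \<in> space \<mu>. Arg2pi z < u} \<in> sets \<mu>"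
    by measurable
  have "integrable \<mu> Arg2pi"
    using Arg2pi by (intro integrable_const_bound[of _ "2 * pi"]) (auto simp: less_imp_le)
  have "(\<integral>x. x \<partial>circle_window \<mu> u) = (\<integral>z. arg_from u z \<partial>\<mu>)"
    unfolding circle_window_eq_distr[OF assms] by (intro integral_distr arg_from_measurable \<mu>) simp
  \<comment> \<open>Moving the cut from 0 to u lifts exactly the points with argument below u by one
    period.\<close>
  also have "\<dots> = (\<integral>z. Arg2pi z + 2 * pi * indicator {z \<in> space \<mu>. Arg2pi z < u} z \<partial>\<mu>)"
    by (intro Bochner_Integration.integral_cong) (auto simp: arg_from_def indicator_def)
  also have "\<dots> = (\<integral>z. Arg2pi z \<partial>\<mu>) + 2 * pi * measure \<mu> {z \<in> space \<mu>. Arg2pi z < u}"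
    using \<open>integrable \<mu> Arg2pi\<close> S by (subst Bochner_Integration.integral_add) (auto simp: Int_absorb1 less_top[symmetric])
  finally show ?thesis .
qed

lemma smooth_circle_prob_AE_Arg2pi:
  assumes "smooth_circle_prob \<mu>"
  shows "AE z in \<mu>. Arg2pi z \<noteq> x"
proof -
  obtain m where sm: "circle_smooth m" and m: "\<mu> = density circle_haar (\<lambda>z. ennreal (m z))"
    using assms by (auto simp: smooth_circle_prob_def smooth_density_of_def)
  note [measurable] = Arg2pi_measurable_circle_prob[OF circle_prob_haar]
  have cis_m: "cis \<in> measurable (uniform_measure lborel {0..<2 * pi}) circle_borel"
    by (simp add: uniform_measure_def)
  have "{z \<in> space circle_borel. Arg2pi z \<noteq> x} \<in> sets circle_borel"
  proof -
    have "{z \<in> space circle_haar. Arg2pi z \<noteq> x} \<in> sets circle_haar"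
      by measurable
    then show ?thesis
      by (simp add: sets_circle_prob[OF circle_prob_haar] space_circle_prob[OF circle_prob_haar] space_restrict_space)
  qed
  moreover have "AE t in uniform_measure lborel {0..<2 * pi}. Arg2pi (cis t) \<noteq> x"
  proof (rule AE_uniform_measureI)
    show "AE t in lborel. t \<in> {0..<2 * pi} \<longrightarrow> Arg2pi (cis t) \<noteq> x"
      using AE_lborel_singleton[of x] by eventually_elim (auto simp: Arg2pi_cis)
  qed simp
  ultimately have h: "AE z in circle_haar. Arg2pi z \<noteq> x"
    unfolding circle_haar_def by (subst AE_distr_iff[OF cis_m]) auto
  have "circle_differentiable m"
    using sm by (auto simp: circle_smooth_def dest: spec[of _ 0])
  then have "(\<lambda>z. ennreal (m z)) \<in> borel_measurable circle_haar"
    by (intro measurable_compose[OF _ measurable_ennreal] circle_prob_measurable[OF circle_prob_haar]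
      circle_differentiable_imp_continuous)
  with h show ?thesis
    unfolding m by (subst AE_density) auto
qed

text \<open>Without atoms, the window means of \<mu> fill the interval from \<open>a \<mu>\<close>
  to \<open>a \<mu> + 2 * pi\<close>. The measure \<nu> may have atoms, so only its extreme windows
  are used, with means \<open>a \<nu>\<close> and \<open>a \<nu> + 2 * pi\<close>. As
  \<open>a \<mu>\<close> and \<open>a \<nu>\<close> both lie between 0 and \<open>2 * pi\<close>,
  one of the two falls into the interval.\<close>

lemma circle_windows_mean_eq:
  assumes \<mu>: "circle_prob \<mu>" "\<And>x. AE z in \<mu>. Arg2pi z \<noteq> x" and \<nu>: "circle_prob \<nu>"
  obtains u v where "u \<in> {0..2 * pi}" "v \<in> {0..2 * pi}"
    "(\<integral>x. x \<partial>circle_window \<mu> u) = (\<integral>x. x \<partial>circle_window \<nu> v)"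
proof -
  define a where "a M = (\<integral>z. Arg2pi z \<partial>M)" for M :: "complex measure"
  define c where "c M u = measure M {z \<in> space M. Arg2pi z < u}" for M and u :: real
  have mean: "(\<integral>x. x \<partial>circle_window M u) = a M + 2 * pi * c M u" if "circle_prob M" "u \<in> {0..2 * pi}" for M u
    using that by (auto simp: a_def c_def circle_window_mean)
  have c0: "c M 0 = 0" for M
    using Arg2pi by (simp add: c_def not_less[symmetric] del: not_less)
  have c1: "c M (2 * pi) = 1" if "circle_prob M" for M
    using Arg2pi prob_space.prob_space[OF circle_prob_space[OF that]] by (simp add: c_def)
  have a_bounds: "0 \<le> a M" "a M \<le> 2 * pi" if "circle_prob M" for M
  proof -
    interpret prob_space M by (rule circle_prob_space[OF that])
    have "integrable M Arg2pi"
      using Arg2pi by (intro integrable_const_bound[of _ "2 * pi"] Arg2pi_measurable_circle_prob[OF that]) (auto simp: less_imp_le)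
    then show "0 \<le> a M" "a M \<le> 2 * pi"
      unfolding a_def using Arg2pi by (auto intro!: integral_ge_const integral_le_const simp: less_imp_le)
  qed
  note [measurable] = Arg2pi_measurable_circle_prob[OF \<mu>(1)]
  interpret prob_space \<mu> by (rule circle_prob_space[OF \<mu>(1)])
  let ?N = "distr \<mu> borel Arg2pi"
  interpret N: real_distribution ?N
    by (simp add: real_distribution_def real_distribution_axioms_def prob_space_distr)
  have "measure ?N {x} = 0" for x
  proof -
    have "measure ?N {x} = measure \<mu> {z \<in> space \<mu>. Arg2pi z = x}"
      by (subst measure_distr) (auto simp: vimage_def Int_def conj_commute)
    also have "\<dots> = 0"
      using \<mu>(2)[of x] by (intro prob_eq_0_AE) auto
    finally show ?thesis .
  qed
  then have cont: "continuous_on S (cdf ?N)" for S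
    by (intro continuous_at_imp_continuous_on ballI) (simp add: N.isCont_cdf)
  \<comment> \<open>The window mean counts arguments strictly below u and the distribution function
    those up to u; the difference is a null set.\<close>
  have "cdf ?N u = c \<mu> u" for u
  proof -
    have "cdf ?N u = measure \<mu> {z \<in> space \<mu>. Arg2pi z \<le> u}"
      unfolding cdf_def by (subst measure_distr) (auto simp: vimage_def Int_def conj_commute)
    also have "\<dots> = c \<mu> u"
      unfolding c_def using \<mu>(2)[of u] by (intro finite_measure_eq_AE) (auto elim!: eventually_mono)
    finally show ?thesis .
  qed
  then have cont_c: "continuous_on S (c \<mu>)" for S
    using cont by (simp cong: continuous_on_cong)
  have ivt: "\<exists>u\<in>{0..2 * pi}. a \<mu> + 2 * pi * c \<mu> u = y" if "a \<mu> \<le> y" "y \<le> a \<mu> + 2 * pi" for y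
  proof -
    have "continuous_on {0..2 * pi} (\<lambda>u. a \<mu> + 2 * pi * c \<mu> u)"
      by (intro continuous_intros cont_c)
    from IVT'[OF _ _ _ this, of y] show ?thesis
      using that c0 c1[OF \<mu>(1)] by auto
  qed
  note b = a_bounds[OF \<mu>(1)] a_bounds[OF \<nu>]
  show thesis
  proof (cases "a \<mu> \<le> a \<nu>")
    case True
    then obtain u where "u \<in> {0..2 * pi}" "a \<mu> + 2 * pi * c \<mu> u = a \<nu> + 2 * pi * c \<nu> 0"
      using ivt[of "a \<nu>"] b c0 by auto
    then show thesis
      using that[of u 0] mean \<mu>(1) \<nu> by auto
  next
    case False
    then obtain u where "u \<in> {0..2 * pi}" "a \<mu> + 2 * pi * c \<mu> u = a \<nu> + 2 * pi * c \<nu> (2 * pi)"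
      using ivt[of "a \<nu> + 2 * pi"] b c1[OF \<nu>] by auto
    then show thesis
      using that[of u "2 * pi"] mean \<mu>(1) \<nu> by auto
  qed
qed

section \<open>Bounding the transport cost by the product coupling\<close>

lemma distr_pair_snd:
  assumes "prob_space M" "prob_space N"
  shows "distr (M \<Otimes>\<^sub>M N) N snd = N"
proof -
  interpret M: prob_space M by fact
  interpret N: prob_space N by fact
  interpret NM: pair_prob_space N M ..
  have "distr (M \<Otimes>\<^sub>M N) N snd = distr (distr (N \<Otimes>\<^sub>M M) (M \<Otimes>\<^sub>M N) (\<lambda>(x, y). (y, x))) N snd"
    by (simp add: pair_sigma_finite.distr_pair_swap[of M N, symmetric] pair_sigma_finite_def M.sigma_finite_measure_axioms N.sigma_finite_measure_axioms)
  also have "\<dots> = distr (N \<Otimes>\<^sub>M M) N fst"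
    by (subst distr_distr) (auto simp: o_def case_prod_beta)
  also have "\<dots> = N"
    by (rule M.distr_pair_fst)
  finally show ?thesis .
qed

text \<open>All windows lie between 0 and \<open>4 * pi\<close>, so any coupling costs at most the
  square of that length, and the product measure is one. The bound does not depend on u and v and
  hence survives the supremum.\<close>

lemma wasserstein_window_le:
  assumes \<mu>: "circle_prob \<mu>" and \<nu>: "circle_prob \<nu>" and u: "u \<in> {0..2 * pi}" and v: "v \<in> {0..2 * pi}"
  shows "wasserstein 2 (circle_window \<mu> u) (circle_window \<nu> v) \<le> ennreal (4 * pi)"
proof -
  have W: "circle_window \<mu> u = distr \<mu> borel (arg_from u)" "circle_window \<nu> v = distr \<nu> borel (arg_from v)"
    using assms by (auto intro: circle_window_eq_distr)
  note m [measurable] = arg_from_measurable[OF \<mu>, of u] arg_from_measurable[OF \<nu>, of v]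
  interpret \<mu>: prob_space \<mu> by (rule circle_prob_space[OF \<mu>])
  interpret \<nu>: prob_space \<nu> by (rule circle_prob_space[OF \<nu>])
  interpret P: pair_prob_space \<mu> \<nu> ..
  let ?M = "distr \<mu> borel (arg_from u)" and ?N = "distr \<nu> borel (arg_from v)"
  have ps: "prob_space ?M" "prob_space ?N"
    by (auto intro: \<mu>.prob_space_distr \<nu>.prob_space_distr)
  have "?M \<Otimes>\<^sub>M ?N \<in> couplings ?M ?N"
    using prob_space.distr_pair_fst[OF ps(2), of ?M] distr_pair_snd[OF ps]
    by (simp add: couplings_def cong: distr_cong)
  then have "(INF \<pi>\<in>couplings ?M ?N. \<integral>\<^sup>+ (x, y). ennreal (\<bar>x - y\<bar> powr 2) \<partial>\<pi>)
      \<le> (\<integral>\<^sup>+ (x, y). ennreal (\<bar>x - y\<bar> powr 2) \<partial>(?M \<Otimes>\<^sub>M ?N))"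
    by (rule INF_lower)
  also have "\<dots> = (\<integral>\<^sup>+p. ennreal (\<bar>arg_from u (fst p) - arg_from v (snd p)\<bar> powr 2) \<partial>(\<mu> \<Otimes>\<^sub>M \<nu>))"
    using ps by (subst pair_measure_distr)
      (auto simp: nn_integral_distr case_prod_beta prob_space_imp_sigma_finite)
  also have "\<dots> \<le> (\<integral>\<^sup>+p. ennreal ((4 * pi)\<^sup>2) \<partial>(\<mu> \<Otimes>\<^sub>M \<nu>))"
  proof (intro nn_integral_mono ennreal_leI)
    have "0 \<le> arg_from w z" "arg_from w z \<le> 4 * pi" for w z
      using Arg2pi[of z] by (auto simp: arg_from_def)
    then have "\<bar>arg_from u z - arg_from v w\<bar> \<le> 4 * pi" for z w
      by (smt (verit))
    then show "\<bar>arg_from u (fst p) - arg_from v (snd p)\<bar> powr 2 \<le> (4 * pi)\<^sup>2" for p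
      using power_mono[of "\<bar>arg_from u (fst p) - arg_from v (snd p)\<bar>" "4 * pi" 2] by simp
  qed
  also have "\<dots> = ennreal ((4 * pi)\<^sup>2)"
    by (simp add: P.emeasure_space_1)
  finally obtain r where "(INF \<pi>\<in>couplings ?M ?N. \<integral>\<^sup>+ (x, y). ennreal (\<bar>x - y\<bar> powr 2) \<partial>\<pi>) = ennreal r"
    "0 \<le> r" "r \<le> (4 * pi)\<^sup>2"
    by (cases "INF \<pi>\<in>couplings ?M ?N. \<integral>\<^sup>+ (x, y). ennreal (\<bar>x - y\<bar> powr 2) \<partial>\<pi>") (auto simp: top_unique)
  then show ?thesis
    unfolding wasserstein_def W ennreal_root_def
    by (auto simp: powr_half_sqrt intro!: ennreal_leI real_le_lsqrt)
qed

lemma circle_wasserstein_finite: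
  assumes \<mu>: "circle_prob \<mu>" "\<And>x. AE z in \<mu>. Arg2pi z \<noteq> x" and \<nu>: "circle_prob \<nu>"
  shows "circle_wasserstein 2 \<mu> \<nu> \<noteq> \<infinity>"
proof -
  obtain u v where "u \<in> {0..2 * pi}" "v \<in> {0..2 * pi}"
    "(\<integral>x. x \<partial>circle_window \<mu> u) = (\<integral>x. x \<partial>circle_window \<nu> v)"
    by (rule circle_windows_mean_eq[OF \<mu> \<nu>])
  then have "circle_wasserstein 2 \<mu> \<nu> \<le> ennreal (4 * pi)"
    unfolding circle_wasserstein_def Let_def
    by (subst if_not_P) (auto intro!: Sup_least wasserstein_window_le[OF \<mu>(1) \<nu>])
  then show ?thesis
    by (auto simp: top_unique)
qed

section \<open>Non-negativity of the free Fisher information\<close>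

lemma circle_deriv_has_field_derivative:
  assumes "circle_differentiable f" "z \<in> circle"
  shows "((\<lambda>t. f (z * cis t)) has_field_derivative circle_deriv f (z * cis s)) (at s)"
proof -
  have "(\<lambda>t. f (z * cis s * cis t)) differentiable (at 0)"
    using assms by (auto simp: circle_differentiable_def norm_mult)
  then have "((\<lambda>t. f (z * cis s * cis t)) has_field_derivative circle_deriv f (z * cis s)) (at 0)"
    unfolding circle_deriv_def using DERIV_deriv_iff_real_differentiable by blast
  then have "((\<lambda>t. f (z * cis s * cis (t - s))) has_field_derivative circle_deriv f (z * cis s)) (at s)"
    using DERIV_shift[of "\<lambda>t. f (z * cis s * cis (t - s))" "circle_deriv f (z * cis s)" 0 s]
    by (simp add: add.commute)
  then show ?thesis
    by (simp add: mult.assoc cis_mult)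
qed

text \<open>The Lipschitz bound is what cancels the simple pole of the cotangent in the Hilbert
  transform.\<close>

lemma circle_C1_lipschitz:
  assumes f: "circle_differentiable f" and c: "continuous_on circle (circle_deriv f)"
  obtains L where "0 \<le> L" "\<And>z s. z \<in> circle \<Longrightarrow> \<bar>f (z * cis s) - f z\<bar> \<le> L * \<bar>s\<bar>"
proof -
  have "compact (circle_deriv f ` circle)"
    by (intro compact_continuous_image c) auto
  then obtain L where L: "\<And>z. z \<in> circle \<Longrightarrow> \<bar>circle_deriv f z\<bar> \<le> L"
    using compact_imp_bounded bounded_iff by (metis imageI real_norm_def)
  show thesis
  proof (rule that)
    show "0 \<le> L"
      using L[of 1] by simp
    fix z :: complex and s :: real
    assume z: "z \<in> circle"
    have "norm (f (z * cis s) - f (z * cis 0)) \<le> L * norm (s - 0)"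
      using circle_deriv_has_field_derivative[OF f z] L z
      by (intro field_differentiable_bound[of UNIV]) (auto simp: norm_mult)
    then show "\<bar>f (z * cis s) - f z\<bar> \<le> L * \<bar>s\<bar>"
      by simp
  qed
qed

text \<open>With x = |s| / 2 the claim is \<open>x * cos x \<le> sin x\<close> on the first
  quadrant; the difference vanishes at 0 and has derivative \<open>x * sin x\<close>.\<close>

lemma abs_cot_half_le:
  fixes s :: real
  assumes "\<bar>s\<bar> \<le> pi"
  shows "\<bar>cot (s / 2)\<bar> * \<bar>s\<bar> \<le> 2"
proof -
  define x where "x = \<bar>s\<bar> / 2"
  have x: "0 \<le> x" "x \<le> pi / 2"
    using assms by (auto simp: x_def)
  have "sin 0 - 0 * cos 0 \<le> sin x - x * cos x"
  proof (rule DERIV_nonneg_imp_nondecreasing[OF x(1)])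
    fix y assume y: "0 \<le> y" "y \<le> x"
    have "((\<lambda>y. sin y - y * cos y) has_real_derivative y * sin y) (at y)"
      by (auto intro!: derivative_eq_intros)
    moreover have "0 \<le> y * sin y"
      using x y by (intro mult_nonneg_nonneg sin_ge_zero) auto
    ultimately show "\<exists>d. ((\<lambda>y. sin y - y * cos y) has_real_derivative d) (at y) \<and> 0 \<le> d"
      by blast
  qed
  then have le: "x * cos x \<le> sin x"
    by simp
  have "\<bar>cot (s / 2)\<bar> = cot x"
  proof -
    have "0 \<le> cot x"
      using x cos_ge_zero[of x] sin_ge_zero[of x] by (simp add: cot_def)
    then show ?thesis
      by (auto simp: x_def abs_if)
  qed
  moreover have "cot x * x \<le> 1"
  proof (cases "x = 0")
    case False
    then have "0 < sin x"
      using x by (intro sin_gt_zero) auto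
    then show ?thesis
      using le by (simp add: cot_def field_simps)
  qed simp
  ultimately show ?thesis
    by (simp add: x_def)
qed

section \<open>The Hilbert transform as an integral of a bounded kernel\<close>

lemma lborel_integral_odd:
  fixes f :: "real \<Rightarrow> real"
  assumes "\<And>s. f (- s) = - f s"
  shows "(\<integral>s. f s \<partial>lborel) = 0"
  using lborel_integral_real_affine[of "-1" f 0] assms by simp

text \<open>The integrand of the Hilbert transform after substituting y = x + s and subtracting the
  value of m at the singularity. The factor -1 / (2 * pi) is left outside; its sign comes from
  \<open>cot ((x - y) / 2) = - cot (s / 2)\<close>.\<close>

definition hilbert_kernel :: "(complex \<Rightarrow> real) \<Rightarrow> complex \<Rightarrow> real \<Rightarrow> real" where
  "hilbert_kernel m z s = indicator {- pi..pi} s * (cot (s / 2) * (m (z * cis s) - m z))"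

context
  fixes m :: "complex \<Rightarrow> real" and L :: real
  assumes m: "continuous_on circle m"
    and L: "0 \<le> L" "\<And>z s. z \<in> circle \<Longrightarrow> \<bar>m (z * cis s) - m z\<bar> \<le> L * \<bar>s\<bar>"
begin

lemma hilbert_kernel_le:
  assumes "z \<in> circle"
  shows "\<bar>hilbert_kernel m z s\<bar> \<le> 2 * L * indicator {- pi..pi} s"
proof (cases "s \<in> {- pi..pi}")
  case True
  have "\<bar>cot (s / 2)\<bar> * \<bar>m (z * cis s) - m z\<bar> \<le> \<bar>cot (s / 2)\<bar> * (L * \<bar>s\<bar>)"
    by (intro mult_left_mono L assms) auto
  also have "\<dots> = L * (\<bar>cot (s / 2)\<bar> * \<bar>s\<bar>)"
    by simp
  also have "\<dots> \<le> L * 2"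
    using True by (intro mult_left_mono abs_cot_half_le L) auto
  finally show ?thesis
    using True by (simp add: hilbert_kernel_def abs_mult)
qed (simp add: hilbert_kernel_def)

lemma hilbert_kernel_measurable:
  assumes "circle_prob \<mu>"
  shows "(\<lambda>p. hilbert_kernel m (fst p) (snd p)) \<in> borel_measurable (\<mu> \<Otimes>\<^sub>M lborel)"
proof -
  have [measurable]: "fst \<in> borel_measurable (\<mu> \<Otimes>\<^sub>M lborel)"
    using measurable_compose[OF measurable_fst circle_prob_ident_measurable[OF assms]] by auto
  have [simp]: "cis \<in> borel_measurable borel"
    by (intro borel_measurable_continuous_onI continuous_on_cis continuous_on_id)
  have mm: "m \<in> borel_measurable circle_borel"
    by (rule borel_measurable_continuous_on_restrict[OF m])
  have "(\<lambda>p. fst p * cis (snd p)) \<in> measurable (\<mu> \<Otimes>\<^sub>M lborel) circle_borel"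
  proof (rule measurable_circleI)
    show "(\<lambda>p. fst p * cis (snd p)) \<in> borel_measurable (\<mu> \<Otimes>\<^sub>M lborel)"
      using measurable_compose[OF measurable_snd, of cis lborel borel \<mu>] by (intro borel_measurable_times) auto
  qed (auto simp: space_pair_measure space_circle_prob[OF assms] norm_mult)
  note meas = measurable_compose[OF this mm] measurable_compose[OF measurable_fst circle_prob_measurable[OF assms m], of lborel]
  have "(\<lambda>s. indicator {- pi..pi} s :: real) \<in> borel_measurable lborel" "(\<lambda>s :: real. cot (s / 2)) \<in> borel_measurable lborel"
    by (simp_all add: cot_def)
  from this[THEN measurable_compose[OF measurable_snd], of \<mu>] show ?thesis
    unfolding hilbert_kernel_def by (intro borel_measurable_times borel_measurable_diff meas)
qed

lemma hilbert_kernel_measurable_snd: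
  assumes "z \<in> circle"
  shows "hilbert_kernel m z \<in> borel_measurable lborel"
proof -
  have [measurable]: "(\<lambda>s. m (z * cis s)) \<in> borel_measurable lborel"
    using continuous_on_circle_cis[OF continuous_on_circle_mult[OF m assms]]
    by (simp add: borel_measurable_continuous_onI)
  show ?thesis
    unfolding hilbert_kernel_def cot_def by measurable
qed

lemma hilbert_kernel_integral_measurable:
  assumes "circle_prob \<mu>"
  shows "(\<lambda>z. \<integral>s. hilbert_kernel m z s \<partial>lborel) \<in> borel_measurable \<mu>"
  using hilbert_kernel_measurable[OF assms]
  by (intro lborel.borel_measurable_lebesgue_integral) (simp add: case_prod_beta')

lemma hilbert_kernel_bound:
  assumes "z \<in> circle"
  shows "\<bar>hilbert_kernel m z s\<bar> \<le> 2 * L"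
  using hilbert_kernel_le[OF assms, of s] L(1) by (cases "s \<in> {- pi..pi}") auto

lemma hilbert_kernel_integral_le:
  assumes "z \<in> circle"
  shows "\<bar>\<integral>s. hilbert_kernel m z s \<partial>lborel\<bar> \<le> 4 * pi * L"
proof -
  have "norm (\<integral>s. hilbert_kernel m z s \<partial>lborel) \<le> (\<integral>s. 2 * L * indicator {- pi..pi} s \<partial>lborel)"
  proof (rule Bochner_Integration.integral_norm_bound_integral)
    show "integrable lborel (hilbert_kernel m z)"
    proof (rule integrableI_bounded_set[of "{- pi..pi}" _ _ "2 * L"])
      show "AE s in lborel. s \<in> {- pi..pi} \<longrightarrow> norm (hilbert_kernel m z s) \<le> 2 * L"
        using hilbert_kernel_bound[OF assms] by simp
    qed (use hilbert_kernel_measurable_snd[OF assms] in \<open>auto simp: hilbert_kernel_def\<close>)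
  qed (use hilbert_kernel_le[OF assms] in auto)
  then show ?thesis
    by (simp add: mult_ac)
qed

text \<open>By oddness of the cotangent, subtracting \<open>m z\<close> does not change the truncated integrals, and
  it removes the singularity.\<close>

lemma hilbert_pv_tendsto:
  assumes z: "z = cis x"
  shows "((\<lambda>\<epsilon>. LINT y:{x - pi..x + pi} - {x - \<epsilon><..<x + \<epsilon>}|lborel. cot ((x - y) / 2) * m (cis y) / (2 * pi))
    \<longlongrightarrow> - (\<integral>s. hilbert_kernel m z s \<partial>lborel) / (2 * pi)) (at_right 0)"
  (is "(?T \<longlongrightarrow> _) _")
proof -
  have zc: "z \<in> circle"
    by (simp add: z)
  define A where "A \<epsilon> = {- pi..pi} - {- \<epsilon><..<\<epsilon>}" for \<epsilon> :: real
  have A_sets [measurable]: "A \<epsilon> \<in> sets borel" for \<epsilon>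
    by (simp add: A_def)
  have km [measurable]: "hilbert_kernel m z \<in> borel_measurable lborel"
    by (rule hilbert_kernel_measurable_snd[OF zc])
  have T: "?T \<epsilon> = - (\<integral>s. indicator (A \<epsilon>) s * hilbert_kernel m z s \<partial>lborel) / (2 * pi)" if \<epsilon>: "\<epsilon> > 0" for \<epsilon>
  proof -
    have ik: "integrable lborel (\<lambda>s. indicator (A \<epsilon>) s * hilbert_kernel m z s)"
    proof (rule integrableI_bounded_set[of "{- pi..pi}" _ _ "2 * L"])
      show "AE s in lborel. s \<in> {- pi..pi} \<longrightarrow> norm (indicator (A \<epsilon>) s * hilbert_kernel m z s) \<le> 2 * L"
        using hilbert_kernel_bound[OF zc] L(1) by (intro AE_I2) (auto simp: indicator_def)
    qed (auto simp: A_def indicator_def)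
    \<comment> \<open>The bare cotangent is integrable only away from the origin, so it has to be
      split off while the truncation is still in place.\<close>
    have ic: "integrable lborel (\<lambda>s. indicator (A \<epsilon>) s * cot (s / 2))"
    proof (rule integrableI_bounded_set[of "{- pi..pi}" _ _ "2 / \<epsilon>"])
      have "\<bar>cot (s / 2)\<bar> \<le> 2 / \<epsilon>" if "s \<in> A \<epsilon>" for s
      proof -
        have s: "\<epsilon> \<le> \<bar>s\<bar>" "\<bar>s\<bar> \<le> pi"
          using that \<epsilon> by (auto simp: A_def)
        then have "\<bar>cot (s / 2)\<bar> * \<epsilon> \<le> \<bar>cot (s / 2)\<bar> * \<bar>s\<bar>"
          by (intro mult_left_mono) auto
        also have "\<dots> \<le> 2"
          by (rule abs_cot_half_le[OF s(2)])
        finally show ?thesis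
          using \<epsilon> by (simp add: field_simps)
      qed
      then show "AE s in lborel. s \<in> {- pi..pi} \<longrightarrow> norm (indicator (A \<epsilon>) s * cot (s / 2)) \<le> 2 / \<epsilon>"
        using \<epsilon> by (intro AE_I2) (auto simp: indicator_def)
    qed (auto simp: A_def indicator_def cot_def)
    have "?T \<epsilon> = (\<integral>s. indicator ({x - pi..x + pi} - {x - \<epsilon><..<x + \<epsilon>}) (x + s) *
        (cot ((x - (x + s)) / 2) * m (cis (x + s)) / (2 * pi)) \<partial>lborel)"
      unfolding set_lebesgue_integral_def by (subst lborel_integral_real_affine[of 1 _ x]) auto
    also have "\<dots> = (\<integral>s. - (indicator (A \<epsilon>) s * hilbert_kernel m z s + m z * (indicator (A \<epsilon>) s * cot (s / 2))) / (2 * pi) \<partial>lborel)"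
      by (intro Bochner_Integration.integral_cong)
        (auto simp: A_def indicator_def hilbert_kernel_def z cis_mult algebra_simps)
    also have "\<dots> = - ((\<integral>s. indicator (A \<epsilon>) s * hilbert_kernel m z s \<partial>lborel) + m z * (\<integral>s. indicator (A \<epsilon>) s * cot (s / 2) \<partial>lborel)) / (2 * pi)"
      using ik ic by simp
    also have "(\<integral>s. indicator (A \<epsilon>) s * cot (s / 2) \<partial>lborel) = 0"
      by (rule lborel_integral_odd) (auto simp: A_def indicator_def)
    finally show ?thesis
      by simp
  qed
  have "((\<lambda>\<epsilon>. \<integral>s. indicator (A \<epsilon>) s * hilbert_kernel m z s \<partial>lborel) \<longlongrightarrow> (\<integral>s. hilbert_kernel m z s \<partial>lborel)) (at_right 0)"
    \<comment> \<open>Passing to sequences makes dominated convergence applicable.\<close>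
    unfolding tendsto_at_iff_sequentially o_def
  proof (intro allI impI)
    fix X :: "nat \<Rightarrow> real"
    assume X: "\<forall>i. X i \<in> {0<..} - {0}" "X \<longlonglongrightarrow> 0"
    show "(\<lambda>n. \<integral>s. indicator (A (X n)) s * hilbert_kernel m z s \<partial>lborel) \<longlonglongrightarrow> (\<integral>s. hilbert_kernel m z s \<partial>lborel)"
    proof (rule integral_dominated_convergence[where w="\<lambda>s. 2 * L * indicator {- pi..pi} s"])
      show "AE s in lborel. (\<lambda>n. indicator (A (X n)) s * hilbert_kernel m z s) \<longlonglongrightarrow> hilbert_kernel m z s"
      proof (intro AE_I2)
        fix s :: real
        show "(\<lambda>n. indicator (A (X n)) s * hilbert_kernel m z s) \<longlonglongrightarrow> hilbert_kernel m z s"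
        proof (cases "s = 0")
          case True
          \<comment> \<open>The origin lies in none of the truncated sets, but the kernel vanishes
            there, so the pointwise limit is still correct.\<close>
          then show ?thesis
            by (simp add: hilbert_kernel_def)
        next
          case False
          then have "\<forall>\<^sub>F n in sequentially. X n < \<bar>s\<bar>"
            using X(2) by (intro order_tendstoD) auto
          then have "\<forall>\<^sub>F n in sequentially. indicator (A (X n)) s * hilbert_kernel m z s = hilbert_kernel m z s"
            by eventually_elim (auto simp: A_def hilbert_kernel_def indicator_def)
          then show ?thesis
            by (rule tendsto_eventually)
        qed
      qed
      show "AE s in lborel. norm (indicator (A (X n)) s * hilbert_kernel m z s) \<le> 2 * L * indicator {- pi..pi} s" for n
      proof (intro AE_I2)
        show "norm (indicator (A (X n)) s * hilbert_kernel m z s) \<le> 2 * L * indicator {- pi..pi} s" for s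
          using hilbert_kernel_le[OF zc, of s] L(1) by (cases "s \<in> A (X n)") auto
      qed
    qed auto
  qed
  then have "((\<lambda>\<epsilon>. - (\<integral>s. indicator (A \<epsilon>) s * hilbert_kernel m z s \<partial>lborel) / (2 * pi))
      \<longlongrightarrow> - (\<integral>s. hilbert_kernel m z s \<partial>lborel) / (2 * pi)) (at_right 0)"
    by (intro tendsto_intros) auto
  then show ?thesis
    using T by (rule_tac Lim_transform_eventually) (auto simp: eventually_at_filter)
qed

text \<open>For fixed \<open>s\<close>, rotation invariance makes the inner integral over \<open>z\<close> even in \<open>s\<close>, while the
  cotangent is odd.\<close>

lemma hilbert_kernel_double_integral:
  "(\<integral>z. m z * (\<integral>s. hilbert_kernel m z s \<partial>lborel) \<partial>circle_haar) = 0"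
proof -
  note haar = circle_prob_haar
  interpret \<alpha>: prob_space circle_haar by (rule circle_prob_space[OF haar])
  interpret P: pair_sigma_finite circle_haar lborel ..
  have "compact (m ` circle)"
    by (intro compact_continuous_image m) auto
  then obtain B where B: "\<And>z. z \<in> circle \<Longrightarrow> \<bar>m z\<bar> \<le> B"
    using compact_imp_bounded bounded_iff by (metis imageI real_norm_def)
  have "0 \<le> B"
    using B[of 1] by simp
  \<comment> \<open>The autocorrelation of m under rotation. Integrating over z first expresses the
    double integral through c alone.\<close>
  define c where "c s = (\<integral>z. m z * m (z * cis s) \<partial>circle_haar)" for s
  have cont: "continuous_on circle (\<lambda>z. m (z * cis s))" for s
    using continuous_on_circle_mult[OF m, of "cis s"] by (simp add: mult.commute)
  have c_even: "c (- s) = c s" for s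
  proof -
    have "c (- s) = (\<integral>z. m (cis s * z) * m (cis s * z * cis (- s)) \<partial>circle_haar)"
      unfolding c_def
      by (rule integral_circle_haar_rotate[symmetric, where f="\<lambda>z. m z * m (z * cis (- s))"])
        (auto intro!: continuous_intros m cont)
    also have "\<dots> = (\<integral>z. m (z * cis s) * m z \<partial>circle_haar)"
      by (simp add: mult.commute mult.left_commute cis_mult flip: mult.assoc)
    finally show ?thesis
      by (simp add: c_def mult.commute)
  qed
  \<comment> \<open>Justifies the exchange of integrals: the integrand is bounded and supported on a
    set of finite product measure. The unregularised cotangent would not allow this.\<close>
  have int: "integrable (circle_haar \<Otimes>\<^sub>M lborel) (\<lambda>(z, s). m z * hilbert_kernel m z s)"
  proof (rule integrableI_bounded_set[of "circle \<times> {- pi..pi}" _ _ "B * (2 * L)"])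
    show "circle \<times> {- pi..pi} \<in> sets (circle_haar \<Otimes>\<^sub>M lborel)"
      using sets.top[of circle_haar] by (simp add: space_circle_prob[OF haar])
    show "(\<lambda>(z, s). m z * hilbert_kernel m z s) \<in> borel_measurable (circle_haar \<Otimes>\<^sub>M lborel)"
      using hilbert_kernel_measurable[OF haar] measurable_compose[OF measurable_fst circle_prob_measurable[OF haar m]]
      unfolding case_prod_beta' by (intro borel_measurable_times)
    show "emeasure (circle_haar \<Otimes>\<^sub>M lborel) (circle \<times> {- pi..pi}) < \<infinity>"
      using sets.top[of circle_haar] \<alpha>.emeasure_space_1
      by (subst lborel.emeasure_pair_measure_Times) (auto simp: space_circle_prob[OF haar])
    show "AE p in circle_haar \<Otimes>\<^sub>M lborel. p \<in> circle \<times> {- pi..pi} \<longrightarrow> norm (case p of (z, s) \<Rightarrow> m z * hilbert_kernel m z s) \<le> B * (2 * L)"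
    proof (intro AE_I2 impI)
      fix p :: "complex \<times> real" assume "p \<in> circle \<times> {- pi..pi}"
      then show "norm (case p of (z, s) \<Rightarrow> m z * hilbert_kernel m z s) \<le> B * (2 * L)"
        using B \<open>0 \<le> B\<close> hilbert_kernel_le by (auto simp: abs_mult intro!: mult_mono) (metis atLeastAtMost_iff indicator_simps(1) mult.right_neutral)
    qed
    show "AE p in circle_haar \<Otimes>\<^sub>M lborel. p \<notin> circle \<times> {- pi..pi} \<longrightarrow> (case p of (z, s) \<Rightarrow> m z * hilbert_kernel m z s) = 0"
      by (intro AE_I2) (auto simp: space_pair_measure space_circle_prob[OF haar] hilbert_kernel_def indicator_def)
  qed
  have "(\<integral>z. m z * (\<integral>s. hilbert_kernel m z s \<partial>lborel) \<partial>circle_haar) = (\<integral>z. (\<integral>s. m z * hilbert_kernel m z s \<partial>lborel) \<partial>circle_haar)"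
    by simp
  also have "\<dots> = (\<integral>s. (\<integral>z. m z * hilbert_kernel m z s \<partial>circle_haar) \<partial>lborel)"
    by (rule P.Fubini_integral[OF int, symmetric])
  also have "\<dots> = (\<integral>s. indicator {- pi..pi} s * (cot (s / 2) * (c s - c 0)) \<partial>lborel)"
  proof (intro Bochner_Integration.integral_cong refl)
    fix s
    have i: "integrable circle_haar (\<lambda>z. m z * m (z * cis t))" for t
      by (intro circle_prob_integrable[OF haar] continuous_intros m cont)
    have "(\<integral>z. m z * hilbert_kernel m z s \<partial>circle_haar)
        = (\<integral>z. indicator {- pi..pi} s * cot (s / 2) * (m z * m (z * cis s) - m z * m (z * cis 0)) \<partial>circle_haar)"
      by (simp add: hilbert_kernel_def algebra_simps)
    also have "\<dots> = indicator {- pi..pi} s * cot (s / 2) * (c s - c 0)"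
      using i by (simp only: c_def integral_mult_right_zero Bochner_Integration.integral_diff)
    finally show "(\<integral>z. m z * hilbert_kernel m z s \<partial>circle_haar) = indicator {- pi..pi} s * (cot (s / 2) * (c s - c 0))"
      by simp
  qed
  also have "\<dots> = 0"
    by (rule lborel_integral_odd) (auto simp: c_even indicator_def)
  finally show ?thesis .
qed

end

section \<open>The free Fisher information as a variance\<close>

lemma fisher_info_nonneg:
  assumes Q: "circle_C1 Q" and \<mu>: "smooth_circle_prob \<mu>"
  shows "0 \<le> fisher_info Q \<mu>"
proof -
  define m where "m = smooth_density \<mu>"
  have cp: "circle_prob \<mu>"
    using \<mu> by (simp add: smooth_circle_prob_def)
  interpret prob_space \<mu> by (rule circle_prob_space[OF cp])
  have sd: "smooth_density_of \<mu> m"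
    using \<mu> unfolding m_def smooth_density_def smooth_circle_prob_def by (metis someI_ex)
  have diff: "circle_differentiable ((circle_deriv ^^ k) m)" for k
    using sd by (auto simp: smooth_density_of_def circle_smooth_def)
  have m: "continuous_on circle m"
    using diff[of 0] by (auto intro: circle_differentiable_imp_continuous)
  have dm: "continuous_on circle (circle_deriv m)"
    using diff[of 1] by (auto intro: circle_differentiable_imp_continuous)
  obtain L where L: "0 \<le> L" "\<And>z s. z \<in> circle \<Longrightarrow> \<bar>m (z * cis s) - m z\<bar> \<le> L * \<bar>s\<bar>"
    using circle_C1_lipschitz[of m] diff[of 0] dm by auto
  define H where "H z = - (\<integral>s. hilbert_kernel m z s \<partial>lborel) / (2 * pi)" for z
  have Hmeas: "H \<in> borel_measurable M" if "circle_prob M" for M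
    unfolding H_def using hilbert_kernel_integral_measurable[OF m L that] by simp
  have H_eq: "circle_hilbert \<mu> z = H z" if z: "z \<in> circle" for z
  proof -
    \<comment> \<open>The definition of \<open>circle_hilbert\<close> reads z through its angle, so
      z is put into that form.\<close>
    have "z = cis (Arg z)"
      using z by (subst cis_Arg) (auto simp: sgn_eq)
    from hilbert_pv_tendsto[OF m L this] show ?thesis
      unfolding circle_hilbert_def Let_def H_def m_def by (intro tendsto_Lim) auto
  qed
  have H_le: "\<bar>H z\<bar> \<le> 2 * L" if "z \<in> circle" for z
    using hilbert_kernel_integral_le[OF m L that] by (simp add: H_def field_simps)
  have H_int: "(\<integral>z. H z \<partial>\<mu>) = 0"
  proof -
    have "(\<integral>z. H z \<partial>\<mu>) = (\<integral>z. H z \<partial>density circle_haar (\<lambda>z. ennreal (m z)))"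
      using sd by (simp add: smooth_density_of_def)
    also have "\<dots> = (\<integral>z. m z *\<^sub>R H z \<partial>circle_haar)"
      using sd by (intro integral_density Hmeas circle_prob_haar circle_prob_measurable m AE_I2)
        (auto simp: smooth_density_of_def space_circle_prob[OF circle_prob_haar])
    also have "\<dots> = - (\<integral>z. m z * (\<integral>s. hilbert_kernel m z s \<partial>lborel) \<partial>circle_haar) / (2 * pi)"
      by (simp add: H_def)
    also have "\<dots> = 0"
      using hilbert_kernel_double_integral[OF m L] by simp
    finally show ?thesis .
  qed
  let ?q = "circle_deriv Q"
  have q: "continuous_on circle ?q"
    using Q by (simp add: circle_C1_def)
  then have "compact (?q ` circle)"
    by (intro compact_continuous_image) auto
  then obtain B where B: "\<And>z. z \<in> circle \<Longrightarrow> \<bar>?q z\<bar> \<le> B"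
    using compact_imp_bounded bounded_iff by (metis imageI real_norm_def)
  note [measurable] = Hmeas[OF cp] circle_prob_measurable[OF cp q]
  have le: "\<bar>H z - ?q z\<bar> \<le> 2 * L + B" if "z \<in> space \<mu>" for z
    using that H_le[of z] B[of z] by (auto simp: space_circle_prob[OF cp])
  have i: "integrable \<mu> H" "integrable \<mu> ?q" "integrable \<mu> (\<lambda>z. H z - ?q z)" "integrable \<mu> (\<lambda>z. (H z - ?q z)\<^sup>2)"
  proof -
    show "integrable \<mu> H"
      using H_le by (intro integrable_const_bound[of _ "2 * L"] AE_I2) (auto simp: space_circle_prob[OF cp])
    moreover show "integrable \<mu> ?q"
      by (rule circle_prob_integrable[OF cp q])
    ultimately show "integrable \<mu> (\<lambda>z. H z - ?q z)"
      by (rule Bochner_Integration.integrable_diff)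
    show "integrable \<mu> (\<lambda>z. (H z - ?q z)\<^sup>2)"
    proof (rule integrable_const_bound[of _ "(2 * L + B)\<^sup>2"])
      show "AE z in \<mu>. norm ((H z - ?q z)\<^sup>2) \<le> (2 * L + B)\<^sup>2"
        using power_mono[OF le abs_ge_zero, of _ 2] by (intro AE_I2) simp
    qed measurable
  qed
  have "fisher_info Q \<mu> = (\<integral>z. (H z - ?q z)\<^sup>2 \<partial>\<mu>) - (\<integral>z. ?q z \<partial>\<mu>)\<^sup>2"
    unfolding fisher_info_def
    by (intro arg_cong2[where f="(-)"] Bochner_Integration.integral_cong refl) (simp add: H_eq space_circle_prob[OF cp])
  \<comment> \<open>The mean of \<open>H - Q'\<close> is minus the mean of \<open>Q'\<close>; the
    sign disappears in the square.\<close>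
  also have "(\<integral>z. ?q z \<partial>\<mu>)\<^sup>2 = (\<integral>z. H z - ?q z \<partial>\<mu>)\<^sup>2"
    using i by (simp add: H_int)
  also have "(\<integral>z. (H z - ?q z)\<^sup>2 \<partial>\<mu>) - (\<integral>z. H z - ?q z \<partial>\<mu>)\<^sup>2 = variance (\<lambda>z. H z - ?q z)"
    using i by (intro variance_eq[symmetric]) auto
  also have "\<dots> \<ge> 0"
    by (rule variance_positive)
  finally show ?thesis .
qed

section \<open>The inequalities\<close>

text \<open>Completing the square; the maximum over w is attained at
  \<open>sqrt i / (2 * \<rho>)\<close>.\<close>

lemma sqrt_mult_minus_square_le:
  fixes \<rho> i w :: real
  assumes "\<rho> > 0" "0 \<le> i"
  shows "sqrt i * w - \<rho> * w\<^sup>2 \<le> i / (4 * \<rho>)"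
proof -
  have "i / (4 * \<rho>) - (sqrt i * w - \<rho> * w\<^sup>2) = (sqrt i - 2 * \<rho> * w)\<^sup>2 / (4 * \<rho>)"
    using assms by (simp add: field_simps power2_eq_square)
  also have "\<dots> \<ge> 0"
    using assms by simp
  finally show ?thesis
    by simp
qed

text \<open>The conclusion is free of divisions, so d may be zero or negative. For w = 0 the second
  bound forces \<open>d \<le> 0\<close>. Otherwise t measures by how much d / w^2 exceeds C, and the
  worst case is t = 0.\<close>

lemma HWI_T_imp_LSI_bound:
  fixes \<rho> C i w d :: real
  assumes C: "C > 0" "- \<rho> < C" "\<rho> \<le> C" and i: "0 \<le> i"
    and T: "C * w\<^sup>2 \<le> d" and HWI: "d \<le> sqrt i * w - \<rho> * w\<^sup>2"
  shows "(C + \<rho>)\<^sup>2 * d \<le> C * i"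
proof (cases "w = 0")
  case True
  then have "(C + \<rho>)\<^sup>2 * d \<le> 0"
    using HWI by (intro mult_nonneg_nonpos) auto
  with C i show ?thesis
    by (smt (verit) mult_nonneg_nonneg)
next
  case False
  define t where "t = d / w\<^sup>2 - C"
  have w: "0 < w\<^sup>2"
    using False by simp
  have d: "d = (C + t) * w\<^sup>2"
    using w by (simp add: t_def)
  have t: "0 \<le> t"
    using T w by (simp add: t_def field_simps)
  have "(C + t + \<rho>) * w\<^sup>2 \<le> sqrt i * w"
    using HWI d by (simp add: algebra_simps)
  \<comment> \<open>Squaring is legitimate since \<open>C + t + \<rho>\<close> is positive.\<close>
  then have "((C + t + \<rho>) * w\<^sup>2)\<^sup>2 \<le> (sqrt i * w)\<^sup>2"
    using C t w by (intro power_mono) auto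
  then have "((C + t + \<rho>)\<^sup>2 * w\<^sup>2) * w\<^sup>2 \<le> i * w\<^sup>2"
    using i by (simp add: power_mult_distrib power2_eq_square mult_ac)
  then have 1: "(C + t + \<rho>)\<^sup>2 * w\<^sup>2 \<le> i"
    using w by simp
  \<comment> \<open>With denominators cleared, this says that (s + \<rho>)^2 / s at s = C + t is at
    least its value at s = C; here \<open>\<rho> \<le> C\<close> enters.\<close>
  have "0 \<le> t * ((C + \<rho>) * (C - \<rho>) + C * t)"
    using C t by simp
  also have "\<dots> = C * (C + t + \<rho>)\<^sup>2 - (C + \<rho>)\<^sup>2 * (C + t)"
    by (simp add: power2_eq_square algebra_simps)
  finally have "(C + \<rho>)\<^sup>2 * (C + t) * w\<^sup>2 \<le> C * (C + t + \<rho>)\<^sup>2 * w\<^sup>2"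
    using w by (intro mult_right_mono) auto
  also have "\<dots> \<le> C * i"
    using 1 C by (simp add: mult.assoc)
  finally show ?thesis
    by (simp add: d mult.assoc)
qed

section \<open>From inequalities between reals to inequalities for the potential\<close>

context
  fixes Q :: "complex \<Rightarrow> real"
  assumes Q: "circle_C1 Q"
begin

lemma W2_real:
  assumes "smooth_circle_prob \<mu>"
  obtains w where "W2 Q \<mu> = ereal w"
proof -
  have "continuous_on circle Q"
    using Q circle_differentiable_imp_continuous by (simp add: circle_C1_def)
  then have "circle_wasserstein 2 \<mu> (equilibrium Q) \<noteq> \<infinity>"
    using assms smooth_circle_prob_AE_Arg2pi[OF assms]
    by (intro circle_wasserstein_finite circle_prob_equilibrium) (auto simp: smooth_circle_prob_def)
  then show thesis
    using that by (cases "circle_wasserstein 2 \<mu> (equilibrium Q)") (auto simp: W2_def enn2ereal_ennreal)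
qed

lemma HWI_imp_LSI:
  assumes "\<rho> > 0" and HWI: "satisfies_HWI Q \<rho>"
  shows "satisfies_LSI Q \<rho>"
  unfolding satisfies_LSI_def
proof (intro conjI allI impI)
  fix \<mu> assume \<mu>: "smooth_circle_prob \<mu>"
  obtain w where w: "W2 Q \<mu> = ereal w"
    by (rule W2_real[OF \<mu>])
  have "energy Q \<mu> - energy Q (equilibrium Q) \<le> ereal (sqrt (fisher_info Q \<mu>) * w - \<rho> * w\<^sup>2)"
    using HWI \<mu> by (auto simp: satisfies_HWI_def w power2_eq_square)
  also have "\<dots> \<le> ereal (1 / (4 * \<rho>) * fisher_info Q \<mu>)"
    using sqrt_mult_minus_square_le[OF \<open>\<rho> > 0\<close> fisher_info_nonneg[OF Q \<mu>]] by simp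
  finally show "energy Q \<mu> - energy Q (equilibrium Q) \<le> ereal (1 / (4 * \<rho>) * fisher_info Q \<mu>)" .
qed fact

text \<open>Treats together the two branches of \<open>LSI_const\<close> that share a formula; since
  C is positive, \<open>\<rho> \<le> C\<close> holds in both.\<close>

lemma HWI_T_imp_LSI:
  assumes HWI: "satisfies_HWI Q \<rho>" and T: "satisfies_T Q C" and C: "- \<rho> < C" "\<rho> \<le> C"
  shows "satisfies_LSI Q ((C + \<rho>)\<^sup>2 / (4 * C))"
  unfolding satisfies_LSI_def
proof (intro conjI allI impI)
  have C0: "C > 0"
    using T by (simp add: satisfies_T_def)
  show "0 < (C + \<rho>)\<^sup>2 / (4 * C)"
    using C0 C by simp
  fix \<mu> assume \<mu>: "smooth_circle_prob \<mu>"
  let ?D = "energy Q \<mu> - energy Q (equilibrium Q)" and ?i = "fisher_info Q \<mu>"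
  obtain w where w: "W2 Q \<mu> = ereal w"
    by (rule W2_real[OF \<mu>])
  have up: "?D \<le> ereal (sqrt ?i * w - \<rho> * w\<^sup>2)" and low: "ereal (C * w\<^sup>2) \<le> ?D"
    using HWI T \<mu> by (auto simp: satisfies_HWI_def satisfies_T_def w power2_eq_square)
  \<comment> \<open>Finiteness of the energy gap follows from being squeezed between two real
    bounds; no separate estimate of the energies is made.\<close>
  obtain d where d: "?D = ereal d"
    using up low by (cases ?D) auto
  have "(C + \<rho>)\<^sup>2 * d \<le> C * ?i"
    using up low C0 C fisher_info_nonneg[OF Q \<mu>] by (intro HWI_T_imp_LSI_bound[of _ _ _ w]) (auto simp: d)
  then have "d \<le> 1 / (4 * ((C + \<rho>)\<^sup>2 / (4 * C))) * ?i"
    using C0 C by (simp add: field_simps)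
  then show "?D \<le> ereal (1 / (4 * ((C + \<rho>)\<^sup>2 / (4 * C))) * ?i)"
    by (simp add: d)
qed

end

text \<open>The difference of the two sides is (C - \<rho>)^2 / (4 C).\<close>

lemma LSI_const_gt:
  assumes "0 < \<rho>" "\<rho> < C"
  shows "\<rho> < LSI_const C \<rho>"
proof -
  have "0 < (C - \<rho>)\<^sup>2"
    using assms by simp
  then show ?thesis
    using assms by (simp add: LSI_const_def field_simps power2_eq_square)
qed

text \<open>In the branch \<open>\<rho> > C\<close> of the constant, \<rho> is positive and part (1)
  applies; the other branches satisfy \<open>\<rho> \<le> C\<close> and fall under
  \<open>HWI_T_imp_LSI\<close>.\<close>

theorem corollary3:
  fixes Q :: "complex \<Rightarrow> real"
  assumes "circle_C1 Q"
  shows "(\<forall>\<rho>>0. satisfies_HWI Q \<rho> \<longrightarrow> satisfies_LSI Q \<rho>) \<and>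
         (\<forall>\<rho> C. satisfies_HWI Q \<rho> \<and> satisfies_T Q C \<and> C > max 0 (- \<rho>)
            \<longrightarrow> satisfies_LSI Q (LSI_const C \<rho>)) \<and>
         (\<forall>\<rho> C. \<rho> > 0 \<and> C > \<rho> \<longrightarrow> LSI_const C \<rho> > \<rho>)"
  using HWI_imp_LSI[OF assms] HWI_T_imp_LSI[OF assms] LSI_const_gt
  by (auto simp: LSI_const_def)

end
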